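(* Let $N$ be a weakly norming graph. Then every $N$-decomposable graph $H$ has Sidorenko's property.
   Context: For a bipartite graph $H$ and bounded measurable $f:[0,1]^2\to\mathbb{R}$, $\|f\|_{r(H)}:=\left(\int\prod_{ij\in E(H)}|f(x_i,x_j)|\,d\mu^{|V(H)|}\right)^{1/|E(H)|}$ ($\mu$ Lebesgue measure); $H$ is weakly norming if $\|\cdot\|_{r(H)}$ is a norm. A bipartite graph $H$ has Sidorenko's property if $\int f(x,y)\,dx\,dy\le\|f\|_{r(H)}$ for every non-negative bounded measurable symmetric $f:[0,1]^2\to\mathbb{R}$, i.e. $t_H(f)\ge t_{K_2}(f)^{|E(H)|}$ where $t_H(f)=\int\prod_{ij\in E(H)}f(x_i,x_j)$. A tree decomposition of $H$ is a pair $(\mathcal{F},\mathcal{T})$ with $\mathcal{F}$ a family of vertex subsets of $H$ and $\mathcal{T}$ a tree on vertex set $\mathcal{F}$ such that $\bigcup_{X\in\mathcal{F}}X=V(H)$, every edge of $H$ lies inside some $X\in\mathcal{F}$, and $X\cap Y\subseteq Z$ whenever $Z$ lies on the path from $X$ to $Y$ in $\mathcal{T}$. An $N$-decomposition of $H$ is a tree decomposition such that each induced subgraph $H[X]$, $X\in\mathcal{F}$, is isomorphic to $N$, and for every pair $X,Y$ adjacent in $\mathcal{T}$ there is an isomorphism between $H[X]$ and $H[Y]$ fixing $X\cap Y$. A bipartite graph is $N$-decomposable if it has an $N$-decomposition. *)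

theory Defs
  imports "HOL-Analysis.Analysis"
begin

section \<open>Finite simple graphs\<close>

record 'a ugraph =
  vertices :: "'a set"
  edges :: "'a set set"

definition simple_graph :: "'a ugraph \<Rightarrow> bool" where
  "simple_graph G \<longleftrightarrow> finite (vertices G) \<and>
     (\<forall>e \<in> edges G. \<exists>u \<in> vertices G. \<exists>v \<in> vertices G. u \<noteq> v \<and> e = {u, v})"

definition induced_subgraph :: "'a ugraph \<Rightarrow> 'a set \<Rightarrow> 'a ugraph" where
  "induced_subgraph G X = \<lparr>vertices = X, edges = {e \<in> edges G. e \<subseteq> X}\<rparr>"

definition graph_iso :: "('a \<Rightarrow> 'b) \<Rightarrow> 'a ugraph \<Rightarrow> 'b ugraph \<Rightarrow> bool" where
  "graph_iso \<phi> G H \<longleftrightarrow> bij_betw \<phi> (vertices G) (vertices H) \<and>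
     (\<forall>u \<in> vertices G. \<forall>v \<in> vertices G. {u, v} \<in> edges G \<longleftrightarrow> {\<phi> u, \<phi> v} \<in> edges H)"

definition isomorphic :: "'a ugraph \<Rightarrow> 'b ugraph \<Rightarrow> bool" where
  "isomorphic G H \<longleftrightarrow> (\<exists>\<phi>. graph_iso \<phi> G H)"

definition bipartition :: "'a ugraph \<Rightarrow> 'a set \<Rightarrow> 'a set \<Rightarrow> bool" where
  "bipartition G A B \<longleftrightarrow> A \<union> B = vertices G \<and> A \<inter> B = {} \<and>
     (\<forall>e \<in> edges G. \<exists>a \<in> A. \<exists>b \<in> B. e = {a, b})"

definition bipartite :: "'a ugraph \<Rightarrow> bool" where
  "bipartite G \<longleftrightarrow> (\<exists>A B. bipartition G A B)"


section \<open>Trees and tree decompositions\<close>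

definition graph_path :: "'a ugraph \<Rightarrow> 'a list \<Rightarrow> bool" where
  "graph_path G p \<longleftrightarrow> p \<noteq> [] \<and> distinct p \<and> set p \<subseteq> vertices G \<and>
     (\<forall>i. Suc i < length p \<longrightarrow> {p ! i, p ! Suc i} \<in> edges G)"

definition path_between :: "'a ugraph \<Rightarrow> 'a \<Rightarrow> 'a \<Rightarrow> 'a list \<Rightarrow> bool" where
  "path_between G u v p \<longleftrightarrow> graph_path G p \<and> hd p = u \<and> last p = v"

definition graph_cycle :: "'a ugraph \<Rightarrow> 'a list \<Rightarrow> bool" where
  "graph_cycle G p \<longleftrightarrow> graph_path G p \<and> 3 \<le> length p \<and> {last p, hd p} \<in> edges G"

definition connected_graph :: "'a ugraph \<Rightarrow> bool" where
  "connected_graph G \<longleftrightarrow> vertices G \<noteq> {} \<and>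
     (\<forall>u \<in> vertices G. \<forall>v \<in> vertices G. \<exists>p. path_between G u v p)"

definition tree :: "'a ugraph \<Rightarrow> bool" where
  "tree T \<longleftrightarrow> simple_graph T \<and> connected_graph T \<and> (\<nexists>p. graph_cycle T p)"

definition tree_decomposition :: "'a ugraph \<Rightarrow> 'a set set \<Rightarrow> 'a set ugraph \<Rightarrow> bool" where
  "tree_decomposition H F T \<longleftrightarrow>
     (\<forall>X \<in> F. X \<subseteq> vertices H) \<and> tree T \<and> vertices T = F \<and>
     \<Union>F = vertices H \<and>
     (\<forall>e \<in> edges H. \<exists>X \<in> F. e \<subseteq> X) \<and>
     (\<forall>X \<in> F. \<forall>Y \<in> F. \<forall>p. path_between T X Y p \<longrightarrow> (\<forall>Z \<in> set p. X \<inter> Y \<subseteq> Z))"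

definition N_decomposition ::
    "'b ugraph \<Rightarrow> 'a ugraph \<Rightarrow> 'a set set \<Rightarrow> 'a set ugraph \<Rightarrow> bool" where
  "N_decomposition N H F T \<longleftrightarrow> tree_decomposition H F T \<and>
     (\<forall>X \<in> F. isomorphic (induced_subgraph H X) N) \<and>
     (\<forall>X \<in> F. \<forall>Y \<in> F. {X, Y} \<in> edges T \<longrightarrow>
        (\<exists>\<phi>. graph_iso \<phi> (induced_subgraph H X) (induced_subgraph H Y) \<and>
             (\<forall>v \<in> X \<inter> Y. \<phi> v = v)))"

definition N_decomposable :: "'b ugraph \<Rightarrow> 'a ugraph \<Rightarrow> bool" where
  "N_decomposable N H \<longleftrightarrow> bipartite H \<and> (\<exists>F T. N_decomposition N H F T)"


section \<open>Graph densities and graph norms\<close>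

abbreviation unit_square :: "(real \<times> real) set" where
  "unit_square \<equiv> {0..1} \<times> {0..1}"

text \<open>A function on the unit square is represented by a function on the plane whose values off
  the square are irrelevant.\<close>

definition bounded_measurable :: "(real \<times> real \<Rightarrow> real) set" where
  "bounded_measurable = {f \<in> borel_measurable (lebesgue_on unit_square).
     \<exists>C. \<forall>p \<in> unit_square. \<bar>f p\<bar> \<le> C}"

text \<open>Lebesgue measure on $[0,1]^V$. The completion makes
  $x \mapsto f(x_i, x_j)$ measurable for every Lebesgue measurable \<open>f\<close>, not only for Borel \<open>f\<close>.\<close>

definition cube_measure :: "'a set \<Rightarrow> ('a \<Rightarrow> real) measure" where
  "cube_measure V = completion (Pi\<^sub>M V (\<lambda>_. restrict_space lborel {0..1}))"

text \<open>For \<open>f\<close> that need not be symmetric, $f(x_i, x_j)$ is only meaningful once the ends of the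
  edge \<open>ij\<close> are ordered; as usual for bipartite graphs, \<open>i\<close> is the end in the
  first part \<open>A\<close> and \<open>j\<close> the end in the second part \<open>B\<close>. For symmetric \<open>f\<close> the
  value does not depend on the bipartition.\<close>

definition hom_density ::
    "'a ugraph \<Rightarrow> 'a set \<Rightarrow> 'a set \<Rightarrow> (real \<times> real \<Rightarrow> real) \<Rightarrow> real" where
  "hom_density H A B f =
     (\<integral>x. (\<Prod>(i, j) \<in> {(i, j). i \<in> A \<and> j \<in> B \<and> {i, j} \<in> edges H}. f (x i, x j))
        \<partial>cube_measure (vertices H))"

definition r_norm ::
    "'a ugraph \<Rightarrow> 'a set \<Rightarrow> 'a set \<Rightarrow> (real \<times> real \<Rightarrow> real) \<Rightarrow> real" where
  "r_norm H A B f = hom_density H A B (\<lambda>p. \<bar>f p\<bar>) powr (1 / real (card (edges H)))"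

text \<open>Functions that agree almost everywhere are identified, so definiteness is almost everywhere.\<close>

definition is_norm :: "((real \<times> real \<Rightarrow> real) \<Rightarrow> real) \<Rightarrow> bool" where
  "is_norm \<nu> \<longleftrightarrow>
     (\<forall>f \<in> bounded_measurable. 0 \<le> \<nu> f) \<and>
     (\<forall>f \<in> bounded_measurable. \<nu> f = 0 \<longleftrightarrow> (AE p in lebesgue_on unit_square. f p = 0)) \<and>
     (\<forall>f \<in> bounded_measurable. \<forall>c. \<nu> (\<lambda>p. c * f p) = \<bar>c\<bar> * \<nu> f) \<and>
     (\<forall>f \<in> bounded_measurable. \<forall>g \<in> bounded_measurable. \<nu> (\<lambda>p. f p + g p) \<le> \<nu> f + \<nu> g)"

text \<open>A disconnected graph may have essentially different bipartitions; it suffices that one of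
  them yields a norm.\<close>

definition weakly_norming :: "'a ugraph \<Rightarrow> bool" where
  "weakly_norming H \<longleftrightarrow> (\<exists>A B. bipartition H A B \<and> is_norm (r_norm H A B))"

text \<open>The form without the root $1/|E(H)|$ is used because it also makes sense for edgeless graphs.\<close>

definition sidorenko_property :: "'a ugraph \<Rightarrow> bool" where
  "sidorenko_property H \<longleftrightarrow> bipartite H \<and>
     (\<forall>A B f. bipartition H A B \<longrightarrow> f \<in> bounded_measurable \<longrightarrow>
        (\<forall>p \<in> unit_square. 0 \<le> f p) \<longrightarrow>
        (\<forall>x \<in> {0..1}. \<forall>y \<in> {0..1}. f (x, y) = f (y, x)) \<longrightarrow>
        (\<integral>p. f p \<partial>lebesgue_on unit_square) ^ card (edges H) \<le> hom_density H A B f)"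

end

theory Submission
  imports Defs
begin

text \<open>For a map \<open>\<phi>\<close> from \<open>V(H)\<close> to the steps of a symmetric step function \<open>f\<close>, let \<open>w(\<phi>)\<close> be the
  product of the values of \<open>f\<close> over the edges of \<open>H\<close>, so that $t_H(f)$ is the average of \<open>w\<close>.
  By an a.e. approximation it suffices to treat positive step functions, scaled so that
  $t_N(f) = 1$. If \<open>N\<close> is weakly norming, a tensor power argument (Hatami) then gives
  $t_K(f) \le 1$ for every subgraph \<open>K\<close> of \<open>N\<close>; for a single edge, this compares $t_{K_2}(f)$ with
  the norm. For a graph \<open>H\<close> glued from copies of \<open>N\<close>, take the random map that has density
  proportional to the weight on the first bag and extends to each further bag
  conditionally independently, given its values on the intersection with the parent bag. Its
  marginal on every bag is the weighted distribution there, because adjacent bags are isomorphic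
  over their intersection. Its density is $w / G$ where $G$ is a product of extension weights \<open>g\<close>
  of the separators, and $E[\ln g] \ge 1 - t_S(f) \ge 0$ for each separator \<open>S\<close>. Hence
  $t_H(f) = E[G] \ge 1 + E[\ln G] \ge 1$.\<close>

section \<open>Averages over maps and edge weights\<close>

text \<open>Extensional maps stand for all maps from \<open>V\<close> to \<open>\<Omega>\<close>, so
  for finite sets this is the expectation under a uniformly random map. For step functions it
  replaces the integral over the cube.\<close>

definition avg :: "'c set \<Rightarrow> 'v set \<Rightarrow> (('v \<Rightarrow> 'c) \<Rightarrow> real) \<Rightarrow> real" where
  "avg \<Omega> V F = (\<Sum>\<phi> \<in> V \<rightarrow>\<^sub>E \<Omega>. F \<phi>) / real (card \<Omega>) ^ card V"

text \<open>Evaluating \<open>\<alpha>\<close> at the image set of an edge builds in the symmetry of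
  the step function; an edge mapped into a single step is evaluated at a singleton.\<close>

definition edge_weight :: "('c set \<Rightarrow> real) \<Rightarrow> 'v set set \<Rightarrow> ('v \<Rightarrow> 'c) \<Rightarrow> real" where
  "edge_weight \<alpha> K \<phi> = (\<Prod>e\<in>K. \<alpha> (\<phi> ` e))"

lemma edge_weight_cong:
  assumes "\<And>e v. e \<in> K \<Longrightarrow> v \<in> e \<Longrightarrow> \<phi> v = \<psi> v"
  shows "edge_weight \<alpha> K \<phi> = edge_weight \<alpha> K \<psi>"
  unfolding edge_weight_def
  by (intro prod.cong refl arg_cong[where f = \<alpha>] image_cong) (use assms in auto)

lemma edge_weight_Un:
  assumes "finite K" "finite L" "K \<inter> L = {}"
  shows "edge_weight \<alpha> (K \<union> L) \<phi> = edge_weight \<alpha> K \<phi> * edge_weight \<alpha> L \<phi>"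
  using assms by (simp add: edge_weight_def prod.union_disjoint)

lemma edge_weight_image:
  assumes "inj_on ((`) \<zeta>) K"
  shows "edge_weight \<alpha> ((`) \<zeta> ` K) \<phi> = edge_weight \<alpha> K (\<phi> \<circ> \<zeta>)"
  using assms by (simp add: edge_weight_def prod.reindex image_comp)

lemma avg_cong:
  assumes "\<And>\<phi>. \<phi> \<in> V \<rightarrow>\<^sub>E \<Omega> \<Longrightarrow> F \<phi> = G \<phi>"
  shows "avg \<Omega> V F = avg \<Omega> V G"
  unfolding avg_def using assms by (simp cong: sum.cong)

lemma avg_mono:
  assumes "\<And>\<phi>. \<phi> \<in> V \<rightarrow>\<^sub>E \<Omega> \<Longrightarrow> F \<phi> \<le> G \<phi>"
  shows "avg \<Omega> V F \<le> avg \<Omega> V G"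
  unfolding avg_def using assms by (intro divide_right_mono sum_mono) auto

lemma avg_add: "avg \<Omega> V (\<lambda>\<phi>. F \<phi> + G \<phi>) = avg \<Omega> V F + avg \<Omega> V G"
  by (simp add: avg_def sum.distrib add_divide_distrib)

lemma avg_diff: "avg \<Omega> V (\<lambda>\<phi>. F \<phi> - G \<phi>) = avg \<Omega> V F - avg \<Omega> V G"
  by (simp add: avg_def sum_subtractf diff_divide_distrib)

lemma avg_cmult: "avg \<Omega> V (\<lambda>\<phi>. c * F \<phi>) = c * avg \<Omega> V F"
  by (simp add: avg_def sum_distrib_left)

lemma avg_const:
  assumes "finite \<Omega>" "\<Omega> \<noteq> {}" "finite V"
  shows "avg \<Omega> V (\<lambda>_. c) = c"
  using assms by (simp add: avg_def card_PiE)

lemma avg_pos: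
  assumes "finite \<Omega>" "\<Omega> \<noteq> {}" "finite V" "\<And>\<phi>. \<phi> \<in> V \<rightarrow>\<^sub>E \<Omega> \<Longrightarrow> 0 < F \<phi>"
  shows "0 < avg \<Omega> V F"
  unfolding avg_def using assms
  by (intro divide_pos_pos sum_pos) (auto simp: finite_PiE PiE_eq_empty_iff card_gt_0_iff)

text \<open>Fubini for finite averages: a map on a disjoint union is a pair of maps, rejoined by
  \<open>override_on\<close>.\<close>

lemma avg_Un:
  assumes "finite V" "finite W" "V \<inter> W = {}"
  shows "avg \<Omega> (V \<union> W) F = avg \<Omega> V (\<lambda>\<phi>. avg \<Omega> W (\<lambda>\<psi>. F (override_on \<phi> \<psi> W)))"
proof -
  have "(\<Sum>\<xi> \<in> ((V \<union> W) \<rightarrow>\<^sub>E \<Omega>). F \<xi>) =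
      (\<Sum>(\<phi>, \<psi>) \<in> (V \<rightarrow>\<^sub>E \<Omega>) \<times> (W \<rightarrow>\<^sub>E \<Omega>). F (override_on \<phi> \<psi> W))"
    by (rule sum.reindex_bij_witness[where j = "\<lambda>\<xi>. (restrict \<xi> V, restrict \<xi> W)"
          and i = "\<lambda>(\<phi>, \<psi>). override_on \<phi> \<psi> W"])
      (use assms in \<open>auto simp: override_on_def restrict_def PiE_def extensional_def Pi_def
         fun_eq_iff intro!: arg_cong[where f = F]\<close>)
  then show ?thesis
    using assms
    by (simp add: avg_def sum.cartesian_product[symmetric] card_Un_disjoint power_add
        sum_divide_distrib field_simps)
qed

lemma avg_restrict:
  assumes "finite \<Omega>" "\<Omega> \<noteq> {}" "finite V" "W \<subseteq> V"
  shows "avg \<Omega> V (\<lambda>\<phi>. F (restrict \<phi> W)) = avg \<Omega> W F"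
proof -
  have fin: "finite W" "finite (V - W)" and V: "V = W \<union> (V - W)"
    using assms finite_subset by auto
  have "avg \<Omega> (W \<union> (V - W)) (\<lambda>\<phi>. F (restrict \<phi> W)) =
      avg \<Omega> W (\<lambda>\<phi>. avg \<Omega> (V - W) (\<lambda>\<psi>. F (restrict (override_on \<phi> \<psi> (V - W)) W)))"
    by (rule avg_Un) (use fin in auto)
  also have "\<dots> = avg \<Omega> W (\<lambda>\<phi>. avg \<Omega> (V - W) (\<lambda>\<psi>. F \<phi>))"
    by (intro avg_cong arg_cong[where f = F])
       (auto simp: override_on_def restrict_def fun_eq_iff PiE_def extensional_def)
  finally show ?thesis using V assms fin by (simp add: avg_const)
qed

lemma avg_bij:
  assumes "bij_betw \<zeta> V W"
  shows "avg \<Omega> V F = avg \<Omega> W (\<lambda>\<psi>. F (restrict (\<psi> \<circ> \<zeta>) V))"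
proof -
  have inj: "inj_on \<zeta> V" and im: "\<zeta> ` V = W" using assms by (auto simp: bij_betw_def)
  let ?i = "\<lambda>\<psi>. restrict (\<psi> \<circ> \<zeta>) V" and ?j = "\<lambda>\<phi>. restrict (\<phi> \<circ> the_inv_into V \<zeta>) W"
  have "(\<Sum>\<phi> \<in> V \<rightarrow>\<^sub>E \<Omega>. F \<phi>) = (\<Sum>\<psi> \<in> W \<rightarrow>\<^sub>E \<Omega>. F (?i \<psi>))"
  proof (rule sum.reindex_bij_witness[where j = ?j and i = ?i])
    fix \<phi> assume \<phi>: "\<phi> \<in> V \<rightarrow>\<^sub>E \<Omega>"
    show *: "?i (?j \<phi>) = \<phi>"
      using \<phi> inj im by (auto simp: fun_eq_iff the_inv_into_f_f restrict_def PiE_def extensional_def)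
    show "F (?i (?j \<phi>)) = F \<phi>" by (simp only: *)
    show "?j \<phi> \<in> W \<rightarrow>\<^sub>E \<Omega>"
      using \<phi> inj im by (auto simp: the_inv_into_f_f)
  next
    fix \<psi> assume \<psi>: "\<psi> \<in> W \<rightarrow>\<^sub>E \<Omega>"
    show "?j (?i \<psi>) = \<psi>"
      using \<psi> inj im
      by (auto simp: fun_eq_iff the_inv_into_f_f restrict_def PiE_def extensional_def)
    show "?i \<psi> \<in> V \<rightarrow>\<^sub>E \<Omega>"
      using \<psi> im by auto
  qed
  then show ?thesis using bij_betw_same_card[OF assms] by (simp add: avg_def)
qed

section \<open>Edges of simple graphs under isomorphism, and induction over a connected
  graph\<close>

lemma simple_graph_edge_subset: "simple_graph G \<Longrightarrow> e \<in> edges G \<Longrightarrow> e \<subseteq> vertices G"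
  by (auto simp: simple_graph_def)

lemma simple_graph_finite_edges: "simple_graph G \<Longrightarrow> finite (edges G)"
  by (rule finite_subset[of _ "Pow (vertices G)"])
    (auto simp: simple_graph_def dest: simple_graph_edge_subset)

lemma simple_graph_induced:
  assumes "simple_graph H" "X \<subseteq> vertices H"
  shows "simple_graph (induced_subgraph H X)"
  using assms finite_subset[of X "vertices H"]
  unfolding simple_graph_def induced_subgraph_def by fastforce

lemma graph_iso_edges:
  assumes "graph_iso \<zeta> G H" "simple_graph G" "simple_graph H"
  shows "edges H = (`) \<zeta> ` edges G"
proof -
  have bij: "bij_betw \<zeta> (vertices G) (vertices H)"
    and iff: "\<And>u v. u \<in> vertices G \<Longrightarrow> v \<in> vertices G \<Longrightarrow>
      {u, v} \<in> edges G \<longleftrightarrow> {\<zeta> u, \<zeta> v} \<in> edges H"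
    using assms(1) by (auto simp: graph_iso_def)
  show ?thesis
  proof (intro equalityI subsetI)
    fix e assume e: "e \<in> edges H"
    then obtain u v where uv: "u \<in> vertices H" "v \<in> vertices H" "e = {u, v}"
      using assms(3) by (auto simp: simple_graph_def)
    then obtain u' v' where "u' \<in> vertices G" "v' \<in> vertices G" "u = \<zeta> u'" "v = \<zeta> v'"
      using bij by (metis bij_betw_imp_surj_on imageE)
    then show "e \<in> (`) \<zeta> ` edges G" using e uv iff by (intro image_eqI[of _ _ "{u', v'}"]) auto
  next
    fix e assume "e \<in> (`) \<zeta> ` edges G"
    then obtain d where d: "d \<in> edges G" "e = \<zeta> ` d" by auto
    then obtain u v where "u \<in> vertices G" "v \<in> vertices G" "d = {u, v}"
      using assms(2) by (auto simp: simple_graph_def)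
    then show "e \<in> edges H" using d iff by auto
  qed
qed

lemma graph_iso_inj_edges:
  assumes "graph_iso \<zeta> G H" "simple_graph G"
  shows "inj_on ((`) \<zeta>) (edges G)"
proof (rule inj_onI)
  fix d e assume "d \<in> edges G" "e \<in> edges G" "\<zeta> ` d = \<zeta> ` e"
  moreover from this have "d \<subseteq> vertices G" "e \<subseteq> vertices G"
    using assms(2) by (auto dest: simple_graph_edge_subset)
  ultimately show "d = e"
    using assms(1) by (auto simp: graph_iso_def bij_betw_def inj_on_image_eq_iff)
qed

text \<open>Supplies the order in which bags are glued. Each new vertex \<open>Y\<close> hangs on an
  old neighbour \<open>X\<close> that lies on some path from \<open>Y\<close> to every old vertex;
  along these paths the intersection axiom of a tree decomposition confines what \<open>Y\<close>
  shares with old bags to \<open>X\<close>.\<close>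

lemma connected_graph_induct:
  assumes T: "connected_graph T" "finite (vertices T)"
    and base: "\<And>X. X \<in> vertices T \<Longrightarrow> Q {X}"
    and step: "\<And>P X Y. P \<subseteq> vertices T \<Longrightarrow> Q P \<Longrightarrow> X \<in> P \<Longrightarrow> Y \<in> vertices T - P \<Longrightarrow>
      {X, Y} \<in> edges T \<Longrightarrow> (\<And>Z. Z \<in> P \<Longrightarrow> \<exists>p. path_between T Y Z p \<and> X \<in> set p) \<Longrightarrow>
      Q (insert Y P)"
  shows "Q (vertices T)"
proof -
  \<comment> \<open>The paths must stay inside \<open>P\<close>. This invariant keeps
    \<open>Y # q\<close> free of repetitions when a new vertex \<open>Y\<close> is put in front of
    an old path \<open>q\<close>.\<close>
  define linked where "linked P \<longleftrightarrow>
    (\<forall>U\<in>P. \<forall>Z\<in>P. \<exists>p. path_between T U Z p \<and> set p \<subseteq> P)" for P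
  have "\<exists>P. P \<subseteq> vertices T \<and> card P = Suc k \<and> linked P \<and> Q P"
    if "Suc k \<le> card (vertices T)" for k
    using that
  proof (induction k)
    case 0
    obtain X where X: "X \<in> vertices T" using T by (auto simp: connected_graph_def)
    have "path_between T X X [X]" using X by (auto simp: path_between_def graph_path_def)
    then have "linked {X}" unfolding linked_def by force
    then show ?case using X base[OF X] by (intro exI[of _ "{X}"]) auto
  next
    case (Suc k)
    then obtain P where P: "P \<subseteq> vertices T" "card P = Suc k" "linked P" "Q P" by auto
    have "P \<noteq> vertices T" using P Suc.prems by auto
    then obtain V where V: "V \<in> vertices T" "V \<notin> P" using P by auto
    obtain U where U: "U \<in> P" using P(2) by (metis card.empty equals0I nat.distinct(1))
    obtain p where p: "path_between T U V p"
      using T U V P unfolding connected_graph_def by blast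
    \<comment> \<open>The first vertex of the path outside \<open>P\<close> becomes
      \<open>Y\<close>; its predecessor, still in \<open>P\<close>, becomes
      \<open>X\<close>.\<close>
    define i where "i = (LEAST i. i < length p \<and> p ! i \<notin> P)"
    have pne: "p \<noteq> []" and hd: "p ! 0 = U" and last: "p ! (length p - 1) = V"
      using p by (auto simp: path_between_def graph_path_def hd_conv_nth last_conv_nth)
    have ex: "length p - 1 < length p \<and> p ! (length p - 1) \<notin> P" using pne last V by auto
    have i: "i < length p" "p ! i \<notin> P"
      using LeastI[of "\<lambda>i. i < length p \<and> p ! i \<notin> P", OF ex] by (auto simp: i_def)
    have "i \<noteq> 0" using i hd U by metis
    then obtain j where j: "i = Suc j" by (cases i) auto
    have jP: "p ! j \<in> P"
      using not_less_Least[of j "\<lambda>i. i < length p \<and> p ! i \<notin> P"] i j by (auto simp: i_def)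
    define X Y where "X = p ! j" and "Y = p ! i"
    have XY: "X \<in> P" "Y \<in> vertices T - P" "{X, Y} \<in> edges T"
      using p i j jP nth_mem[of i p] by (auto simp: path_between_def graph_path_def X_def Y_def)
    have fwd: "\<exists>p. path_between T Y Z p \<and> X \<in> set p \<and> set p \<subseteq> insert Y P" if Z: "Z \<in> P" for Z
    proof -
      obtain q where q: "path_between T X Z q" "set q \<subseteq> P"
        using P(3) XY Z unfolding linked_def by blast
      have "q \<noteq> []" using q by (auto simp: path_between_def graph_path_def)
      then have "path_between T Y Z (Y # q)"
        using q XY
        by (auto simp: path_between_def graph_path_def nth_Cons hd_conv_nth insert_commute split: nat.splits)
      moreover have "X \<in> set q" using q \<open>q \<noteq> []\<close> by (auto simp: path_between_def)
      ultimately show ?thesis using q by (intro exI[of _ "Y # q"]) auto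
    qed
    have bwd: "\<exists>p. path_between T Z Y p \<and> set p \<subseteq> insert Y P" if Z: "Z \<in> P" for Z
    proof -
      obtain q where q: "path_between T Z X q" "set q \<subseteq> P"
        using P(3) XY Z unfolding linked_def by blast
      have qne: "q \<noteq> []" using q by (auto simp: path_between_def graph_path_def)
      have "{(q @ [Y]) ! i, (q @ [Y]) ! Suc i} \<in> edges T" if "Suc i < length (q @ [Y])" for i
      proof (cases "Suc i < length q")
        case True
        then show ?thesis using q by (auto simp: path_between_def graph_path_def nth_append)
      next
        case False
        then have "i = length q - 1" using that by auto
        then show ?thesis using q XY qne
          by (auto simp: path_between_def nth_append last_conv_nth)
      qed
      then have "path_between T Z Y (q @ [Y])"
        using q XY qne by (auto simp: path_between_def graph_path_def)
      then show ?thesis using q by (intro exI[of _ "q @ [Y]"]) auto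
    qed
    have "path_between T Y Y [Y]" using XY by (auto simp: path_between_def graph_path_def)
    then have YY: "\<exists>p. path_between T Y Y p \<and> set p \<subseteq> insert Y P" by force
    have "linked (insert Y P)"
      unfolding linked_def
    proof (intro ballI)
      fix U Z assume UZ: "U \<in> insert Y P" "Z \<in> insert Y P"
      show "\<exists>p. path_between T U Z p \<and> set p \<subseteq> insert Y P"
      proof (cases "U = Y")
        case True
        then show ?thesis using UZ YY fwd[of Z] by blast
      next
        case False
        then show ?thesis using UZ bwd[of U] P(3) unfolding linked_def by blast
      qed
    qed
    moreover have "Q (insert Y P)"
      by (rule step[OF P(1) P(4) XY]) (use fwd in blast)
    moreover have "card (insert Y P) = Suc (Suc k)"
      using XY P finite_subset[OF P(1) T(2)] by auto
    ultimately show ?case using XY P by (intro exI[of _ "insert Y P"]) auto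
  qed
  from this[of "card (vertices T) - 1"]
  obtain P where "P \<subseteq> vertices T" "card P = card (vertices T)" "Q P"
    using T by (metis One_nat_def Suc_pred card_gt_0_iff connected_graph_def order_refl)
  then show ?thesis using card_subset_eq[OF T(2)] by auto
qed


section \<open>Gluing along a tree decomposition\<close>

text \<open>For a single set, \<open>covered_edges H {S}\<close> is the edge set of the subgraph
  induced on \<open>S\<close>, also when \<open>S\<close> is a separator and not a bag. For a
  family, only edges inside one of its members count.\<close>

definition covered_edges :: "'a ugraph \<Rightarrow> 'a set set \<Rightarrow> 'a set set" where
  "covered_edges H P = {e \<in> edges H. \<exists>X \<in> P. e \<subseteq> X}"

lemma edges_induced_subgraph: "edges (induced_subgraph H X) = covered_edges H {X}"
  by (auto simp: induced_subgraph_def covered_edges_def)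

locale positive_target =
  fixes \<Omega> :: "'c set" and \<alpha> :: "'c set \<Rightarrow> real"
  assumes finite_target: "finite \<Omega>" and nonempty_target: "\<Omega> \<noteq> {}"
    and positive: "\<And>S. 0 < \<alpha> S"
begin

abbreviation weight where "weight \<equiv> edge_weight \<alpha>"

lemma weight_pos: "0 < weight K \<phi>"
  by (simp add: edge_weight_def positive prod_pos)

text \<open>The normalising factor of the conditional law on \<open>Y\<close> given the values
  \<open>\<sigma>\<close> on \<open>S\<close>. Its product with the weight of \<open>S\<close> is
  the density on \<open>S\<close> of the marginal of the weighted distribution on
  \<open>Y\<close>.\<close>

definition extension_weight :: "'a ugraph \<Rightarrow> 'a set \<Rightarrow> 'a set \<Rightarrow> ('a \<Rightarrow> 'c) \<Rightarrow> real" where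
  "extension_weight H S Y \<sigma> = avg \<Omega> (Y - S)
     (\<lambda>\<psi>. weight (covered_edges H {Y} - covered_edges H {S}) (override_on \<sigma> \<psi> (Y - S)))"

lemma extension_weight_pos: "finite Y \<Longrightarrow> 0 < extension_weight H S Y \<sigma>"
  unfolding extension_weight_def
  by (intro avg_pos) (auto simp: finite_target nonempty_target weight_pos)

text \<open>An edge inside \<open>S\<close> sees only \<open>\<sigma>\<close>, so its factor leaves
  the average over the remaining vertices of \<open>Y\<close>.\<close>

lemma avg_split:
  assumes H: "simple_graph H" and Y: "finite Y" and S: "S \<subseteq> Y"
  shows "avg \<Omega> Y (\<lambda>\<phi>. weight (covered_edges H {Y}) \<phi> * h \<phi>) =
    avg \<Omega> S (\<lambda>\<sigma>. weight (covered_edges H {S}) \<sigma> * avg \<Omega> (Y - S) (\<lambda>\<psi>.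
      weight (covered_edges H {Y} - covered_edges H {S}) (override_on \<sigma> \<psi> (Y - S)) *
      h (override_on \<sigma> \<psi> (Y - S))))"
proof -
  have fin: "finite S" "finite (Y - S)" and YS: "Y = S \<union> (Y - S)" using finite_subset S Y by auto
  have finE: "finite (covered_edges H Q)" for Q
    using simple_graph_finite_edges[OF H] by (simp add: covered_edges_def)
  have "covered_edges H {Y} = covered_edges H {S} \<union> (covered_edges H {Y} - covered_edges H {S})"
    using S by (auto simp: covered_edges_def)
  then have w: "weight (covered_edges H {Y}) \<phi> = weight (covered_edges H {S}) \<phi> *
      weight (covered_edges H {Y} - covered_edges H {S}) \<phi>" for \<phi> :: "'a \<Rightarrow> 'c"
    using edge_weight_Un[of "covered_edges H {S}" "covered_edges H {Y} - covered_edges H {S}" \<alpha> \<phi>]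
      finE by auto
  have wS: "weight (covered_edges H {S}) (override_on \<sigma> \<psi> (Y - S)) = weight (covered_edges H {S}) \<sigma>"
    for \<sigma> \<psi> :: "'a \<Rightarrow> 'c"
    by (rule edge_weight_cong) (auto simp: covered_edges_def override_on_def)
  have "avg \<Omega> (S \<union> (Y - S)) (\<lambda>\<phi>. weight (covered_edges H {Y}) \<phi> * h \<phi>) =
      avg \<Omega> S (\<lambda>\<sigma>. avg \<Omega> (Y - S) (\<lambda>\<psi>. weight (covered_edges H {Y}) (override_on \<sigma> \<psi> (Y - S)) *
        h (override_on \<sigma> \<psi> (Y - S))))"
    by (rule avg_Un) (use fin in auto)
  then show ?thesis
    using YS by (simp add: w wS mult.assoc avg_cmult)
qed

text \<open>The isomorphism fixes the separator pointwise, hence carries the remaining vertices and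
  edges of \<open>X\<close> bijectively to those of \<open>Y\<close>; extensions of
  \<open>\<sigma>\<close> correspond by relabelling. Here the compatibility of adjacent bags in an
  N-decomposition enters.\<close>

lemma extension_weight_iso:
  assumes H: "simple_graph H" and XY: "X \<subseteq> vertices H" "Y \<subseteq> vertices H"
    and iso: "graph_iso \<zeta> (induced_subgraph H X) (induced_subgraph H Y)"
    and fixed: "\<And>v. v \<in> X \<inter> Y \<Longrightarrow> \<zeta> v = v"
  shows "extension_weight H (X \<inter> Y) X \<sigma> = extension_weight H (X \<inter> Y) Y \<sigma>"
proof -
  let ?S = "X \<inter> Y"
  have bij: "bij_betw \<zeta> X Y" using iso by (simp add: graph_iso_def induced_subgraph_def)
  have E: "covered_edges H {Y} = (`) \<zeta> ` covered_edges H {X}"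
    using graph_iso_edges[OF iso] simple_graph_induced[OF H] XY
    by (simp add: edges_induced_subgraph)
  have inj: "inj_on ((`) \<zeta>) (covered_edges H {X})"
    using graph_iso_inj_edges[OF iso] simple_graph_induced[OF H] XY
    by (simp add: edges_induced_subgraph)
  \<comment> \<open>An edge inside the separator has both ends fixed by \<open>\<zeta>\<close>, so
    it is fixed as a set.\<close>
  have "(`) \<zeta> ` covered_edges H {?S} = id ` covered_edges H {?S}"
    by (intro image_cong refl) (use fixed in \<open>force simp: covered_edges_def\<close>)
  then have ES: "(`) \<zeta> ` covered_edges H {?S} = covered_edges H {?S}" by simp
  have sub: "covered_edges H {?S} \<subseteq> covered_edges H {X}" by (auto simp: covered_edges_def)
  have diff: "covered_edges H {Y} - covered_edges H {?S} =
      (`) \<zeta> ` (covered_edges H {X} - covered_edges H {?S})"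
    using inj_on_image_set_diff[OF inj Diff_subset sub] E ES by simp
  have injd: "inj_on ((`) \<zeta>) (covered_edges H {X} - covered_edges H {?S})"
    using inj by (rule inj_on_subset) auto
  have "\<zeta> ` ?S = ?S" using fixed by force
  then have "\<zeta> ` (X - ?S) = Y - ?S"
    using inj_on_image_set_diff[of \<zeta> X X ?S] bij by (auto simp: bij_betw_def)
  then have bijd: "bij_betw \<zeta> (X - ?S) (Y - ?S)"
    using bij by (metis Diff_subset bij_betw_subset)
  have "extension_weight H ?S Y \<sigma> = avg \<Omega> (Y - ?S) (\<lambda>\<psi>.
      weight (covered_edges H {X} - covered_edges H {?S}) (override_on \<sigma> \<psi> (Y - ?S) \<circ> \<zeta>))"
    by (simp add: extension_weight_def diff edge_weight_image[OF injd])
  also have "\<dots> = avg \<Omega> (Y - ?S) (\<lambda>\<psi>. weight (covered_edges H {X} - covered_edges H {?S})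
      (override_on \<sigma> (restrict (\<psi> \<circ> \<zeta>) (X - ?S)) (X - ?S)))"
  proof (intro avg_cong edge_weight_cong)
    fix \<psi> :: "'a \<Rightarrow> 'c" and e v
    assume "e \<in> covered_edges H {X} - covered_edges H {?S}" "v \<in> e"
    then have "v \<in> X" by (auto simp: covered_edges_def)
    show "(override_on \<sigma> \<psi> (Y - ?S) \<circ> \<zeta>) v =
        override_on \<sigma> (restrict (\<psi> \<circ> \<zeta>) (X - ?S)) (X - ?S) v"
    proof (cases "v \<in> Y")
      case True
      then have "\<zeta> v = v" by (rule fixed[OF IntI[OF \<open>v \<in> X\<close>]])
      then show ?thesis using \<open>v \<in> X\<close> True by (simp add: override_on_def)
    next
      case False
      then have "\<zeta> v \<in> Y - ?S" using \<open>v \<in> X\<close> by (intro bij_betwE[OF bijd, rule_format]) simp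
      then have "override_on \<sigma> \<psi> (Y - ?S) (\<zeta> v) = \<psi> (\<zeta> v)"
        by (rule override_on_apply_in)
      then show ?thesis using \<open>v \<in> X\<close> False by simp
    qed
  qed
  also have "\<dots> = extension_weight H ?S X \<sigma>"
    unfolding extension_weight_def by (subst avg_bij[OF bijd]) (rule refl)
  finally show ?thesis ..
qed

text \<open>\<open>weight / G\<close> is the density of a random map on the union of the bags in \<open>P\<close>. The quantifier
  over test functions \<open>h\<close> says that its marginal on each bag \<open>X\<close> has density \<open>weight\<close> of \<open>X\<close>.\<close>

definition gluing :: "'a ugraph \<Rightarrow> 'a set set \<Rightarrow> (('a \<Rightarrow> 'c) \<Rightarrow> real) \<Rightarrow> bool" where
  "gluing H P G \<longleftrightarrow> (\<forall>\<phi> \<in> \<Union>P \<rightarrow>\<^sub>E \<Omega>. 0 < G \<phi>) \<and>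
     (\<forall>X \<in> P. \<forall>h. avg \<Omega> (\<Union>P) (\<lambda>\<phi>. weight (covered_edges H P) \<phi> / G \<phi> * h (restrict \<phi> X)) =
        avg \<Omega> X (\<lambda>\<phi>. weight (covered_edges H {X}) \<phi> * h \<phi>)) \<and>
     0 \<le> avg \<Omega> (\<Union>P) (\<lambda>\<phi>. weight (covered_edges H P) \<phi> / G \<phi> * ln (G \<phi>))"

lemma gluingI:
  assumes "\<And>\<phi>. \<phi> \<in> \<Union>P \<rightarrow>\<^sub>E \<Omega> \<Longrightarrow> 0 < G \<phi>"
    and "\<And>X h. X \<in> P \<Longrightarrow>
      avg \<Omega> (\<Union>P) (\<lambda>\<phi>. weight (covered_edges H P) \<phi> / G \<phi> * h (restrict \<phi> X)) =
        avg \<Omega> X (\<lambda>\<phi>. weight (covered_edges H {X}) \<phi> * h \<phi>)"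
    and "0 \<le> avg \<Omega> (\<Union>P) (\<lambda>\<phi>. weight (covered_edges H P) \<phi> / G \<phi> * ln (G \<phi>))"
  shows "gluing H P G"
  unfolding gluing_def by (intro conjI ballI allI assms)

lemma gluingD:
  assumes "gluing H P G"
  shows "\<phi> \<in> \<Union>P \<rightarrow>\<^sub>E \<Omega> \<Longrightarrow> 0 < G \<phi>"
    and "X \<in> P \<Longrightarrow>
      avg \<Omega> (\<Union>P) (\<lambda>\<phi>. weight (covered_edges H P) \<phi> / G \<phi> * h (restrict \<phi> X)) =
        avg \<Omega> X (\<lambda>\<phi>. weight (covered_edges H {X}) \<phi> * h \<phi>)"
    and "0 \<le> avg \<Omega> (\<Union>P) (\<lambda>\<phi>. weight (covered_edges H P) \<phi> / G \<phi> * ln (G \<phi>))"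
proof -
  show "0 < G \<phi>" if "\<phi> \<in> \<Union>P \<rightarrow>\<^sub>E \<Omega>"
    by (rule bspec[OF conjunct1[OF assms[unfolded gluing_def]] that])
  show "avg \<Omega> (\<Union>P) (\<lambda>\<phi>. weight (covered_edges H P) \<phi> / G \<phi> * h (restrict \<phi> X)) =
        avg \<Omega> X (\<lambda>\<phi>. weight (covered_edges H {X}) \<phi> * h \<phi>)" if "X \<in> P"
    by (rule spec[OF bspec[OF conjunct1[OF conjunct2[OF assms[unfolded gluing_def]]] that]])
  show "0 \<le> avg \<Omega> (\<Union>P) (\<lambda>\<phi>. weight (covered_edges H P) \<phi> / G \<phi> * ln (G \<phi>))"
    by (rule conjunct2[OF conjunct2[OF assms[unfolded gluing_def]]])
qed

lemma gluing_singleton: "finite X \<Longrightarrow> gluing H {X} (\<lambda>_. 1)"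
  by (rule gluingI) (auto simp: avg_const finite_target nonempty_target intro!: avg_cong)

text \<open>The random map is extended to the new vertices of \<open>Y\<close> with conditional
  density \<open>weight L / g\<close> given its values on the separator, so \<open>g\<close> joins
  the product \<open>G\<close>. By the isomorphism the law on the separator is the same seen from
  \<open>X\<close> as from \<open>Y\<close>, and therefore the new bag also receives its weighted
  distribution.\<close>

lemma gluing_insert:
  assumes H: "simple_graph H" and sub: "\<And>Z. Z \<in> P \<Longrightarrow> Z \<subseteq> vertices H" and Y: "Y \<subseteq> vertices H"
    and glued: "gluing H P G" and X: "X \<in> P" and meet: "Y \<inter> \<Union>P = X \<inter> Y"
    and iso: "graph_iso \<zeta> (induced_subgraph H X) (induced_subgraph H Y)"
    and fixed: "\<And>v. v \<in> X \<inter> Y \<Longrightarrow> \<zeta> v = v"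
    and total: "avg \<Omega> X (weight (covered_edges H {X})) = 1"
    and separator: "avg \<Omega> (X \<inter> Y) (weight (covered_edges H {X \<inter> Y})) \<le> 1"
  shows "\<exists>G'. gluing H (insert Y P) G'"
proof -
  define S D V where "S = X \<inter> Y" and "D = Y - S" and "V = \<Union>P"
  define L where "L = covered_edges H {Y} - covered_edges H {S}"
  define g where "g = extension_weight H S Y"
  have G: "0 < G \<phi>" if "\<phi> \<in> V \<rightarrow>\<^sub>E \<Omega>" for \<phi>
    using gluingD(1)[OF glued] that unfolding V_def .
  have marg: "avg \<Omega> V (\<lambda>\<phi>. weight (covered_edges H P) \<phi> / G \<phi> * h (restrict \<phi> Z)) =
        avg \<Omega> Z (\<lambda>\<phi>. weight (covered_edges H {Z}) \<phi> * h \<phi>)" if "Z \<in> P" for Z h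
    using gluingD(2)[OF glued that] unfolding V_def .
  have ent: "0 \<le> avg \<Omega> V (\<lambda>\<phi>. weight (covered_edges H P) \<phi> / G \<phi> * ln (G \<phi>))"
    using gluingD(3)[OF glued] unfolding V_def .
  define \<nu> where "\<nu> = (\<lambda>\<phi>. weight (covered_edges H P) \<phi> / G \<phi>)"
  define G' where "G' = (\<lambda>\<phi>. G (restrict \<phi> V) * g (restrict \<phi> S))"
  have finH: "finite (vertices H)" using H by (simp add: simple_graph_def)
  have "V \<subseteq> vertices H" using sub by (auto simp: V_def)
  then have fin: "finite V" "finite Y" "finite X" "finite D" "finite S"
    using finite_subset[OF _ finH] sub X Y by (auto simp: D_def S_def)
  have VD: "V \<inter> D = {}" "\<Union>(insert Y P) = V \<union> D" and SX: "S \<subseteq> X" "S \<subseteq> V" "S \<subseteq> Y"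
    using meet X by (auto simp: V_def D_def S_def)
  have finE: "finite (covered_edges H Q)" for Q
    using simple_graph_finite_edges[OF H] by (simp add: covered_edges_def)
  have gpos: "0 < g \<sigma>" for \<sigma> using extension_weight_pos fin by (simp add: g_def)
  then have gne: "g \<sigma> \<noteq> 0" for \<sigma> by (metis less_irrefl)
  have rV: "restrict (override_on \<phi> \<psi> D) V = \<phi>" if "\<phi> \<in> V \<rightarrow>\<^sub>E \<Omega>" for \<phi> \<psi>
    using that VD by (auto simp: fun_eq_iff override_on_def restrict_def PiE_def extensional_def)
  have rS: "restrict (override_on \<phi> \<psi> D) S = restrict \<phi> S" for \<phi> \<psi> :: "'a \<Rightarrow> 'c"
    by (auto simp: fun_eq_iff override_on_def D_def)
  have rY: "restrict (override_on \<phi> \<psi> D) Y = override_on (restrict \<phi> S) \<psi> D"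
    if "\<psi> \<in> D \<rightarrow>\<^sub>E \<Omega>" for \<phi> \<psi>
    using that SX by (auto simp: fun_eq_iff override_on_def D_def)
  \<comment> \<open>An edge of \<open>L\<close> inside an old bag would lie in
    \<open>Y \<inter> \<Union>P = S\<close>, which \<open>L\<close> excludes; so no edge is counted
    twice.\<close>
  have cov: "covered_edges H (insert Y P) = covered_edges H P \<union> L" "covered_edges H P \<inter> L = {}"
    using meet X by (auto simp: covered_edges_def L_def S_def)
  have w: "weight (covered_edges H (insert Y P)) (override_on \<phi> \<psi> D) =
      weight (covered_edges H P) \<phi> * weight L (override_on (restrict \<phi> S) \<psi> D)"
    for \<phi> \<psi> :: "'a \<Rightarrow> 'c"
  proof -
    have "weight (covered_edges H P) (override_on \<phi> \<psi> D) = weight (covered_edges H P) \<phi>"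
      by (rule edge_weight_cong) (use VD in \<open>auto simp: covered_edges_def override_on_def V_def\<close>)
    moreover have "weight L (override_on \<phi> \<psi> D) = weight L (override_on (restrict \<phi> S) \<psi> D)"
      by (rule edge_weight_cong) (auto simp: L_def covered_edges_def override_on_def D_def)
    moreover have "weight (covered_edges H P \<union> L) (override_on \<phi> \<psi> D) =
        weight (covered_edges H P) (override_on \<phi> \<psi> D) * weight L (override_on \<phi> \<psi> D)"
      using finE cov(2) by (intro edge_weight_Un) (auto simp: L_def)
    ultimately show ?thesis by (simp add: cov(1))
  qed
  \<comment> \<open>The new vertices are averaged out first; apart from \<open>weight L\<close> and
    \<open>F\<close>, every factor depends on old values only.\<close>
  have star: "avg \<Omega> (V \<union> D) (\<lambda>\<phi>. weight (covered_edges H (insert Y P)) \<phi> / G' \<phi> * F \<phi>) =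
      avg \<Omega> V (\<lambda>\<phi>. \<nu> \<phi> * (avg \<Omega> D (\<lambda>\<psi>. weight L (override_on (restrict \<phi> S) \<psi> D) *
        F (override_on \<phi> \<psi> D)) / g (restrict \<phi> S)))" for F
  proof -
    have "avg \<Omega> (V \<union> D) (\<lambda>\<phi>. weight (covered_edges H (insert Y P)) \<phi> / G' \<phi> * F \<phi>) =
      avg \<Omega> V (\<lambda>\<phi>. avg \<Omega> D (\<lambda>\<psi>. (\<nu> \<phi> / g (restrict \<phi> S)) *
        (weight L (override_on (restrict \<phi> S) \<psi> D) * F (override_on \<phi> \<psi> D))))"
      unfolding avg_Un[OF fin(1,4) VD(1)]
      by (intro avg_cong) (simp add: w G'_def rV rS \<nu>_def)
    then show ?thesis unfolding avg_cmult by (simp add: field_simps)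
  qed
  \<comment> \<open>Observables of the old vertices keep their expectation, because the conditional
    densities average to one.\<close>
  have old: "avg \<Omega> (V \<union> D) (\<lambda>\<phi>. weight (covered_edges H (insert Y P)) \<phi> / G' \<phi> * h (restrict \<phi> V)) =
      avg \<Omega> V (\<lambda>\<phi>. \<nu> \<phi> * h \<phi>)" for h
    unfolding star
  proof (intro avg_cong)
    fix \<phi> assume \<phi>: "\<phi> \<in> V \<rightarrow>\<^sub>E \<Omega>"
    have "avg \<Omega> D (\<lambda>\<psi>. weight L (override_on (restrict \<phi> S) \<psi> D) *
        h (restrict (override_on \<phi> \<psi> D) V)) = h \<phi> * g (restrict \<phi> S)"
      unfolding rV[OF \<phi>]
      by (simp add: g_def extension_weight_def L_def D_def avg_cmult[symmetric] mult.commute)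
    then show "\<nu> \<phi> * (avg \<Omega> D (\<lambda>\<psi>. weight L (override_on (restrict \<phi> S) \<psi> D) *
        h (restrict (override_on \<phi> \<psi> D) V)) / g (restrict \<phi> S)) = \<nu> \<phi> * h \<phi>"
      using gpos[of "restrict \<phi> S"] by simp
  qed
  \<comment> \<open>The law on the separator is read off from the old bag \<open>X\<close>; the
    isomorphism then replaces the extension weight of \<open>X\<close> by that of
    \<open>Y\<close>.\<close>
  have sep: "avg \<Omega> V (\<lambda>\<phi>. \<nu> \<phi> * h (restrict \<phi> S)) =
      avg \<Omega> S (\<lambda>\<sigma>. weight (covered_edges H {S}) \<sigma> * (g \<sigma> * h \<sigma>))" for h
  proof -
    have "avg \<Omega> V (\<lambda>\<phi>. \<nu> \<phi> * h (restrict \<phi> S)) =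
        avg \<Omega> V (\<lambda>\<phi>. \<nu> \<phi> * h (restrict (restrict \<phi> X) S))"
      using SX by (simp add: Int_absorb1)
    also have "\<dots> = avg \<Omega> X (\<lambda>\<phi>. weight (covered_edges H {X}) \<phi> * h (restrict \<phi> S))"
      unfolding \<nu>_def by (rule marg[OF X])
    also have "\<dots> = avg \<Omega> S (\<lambda>\<sigma>. weight (covered_edges H {S}) \<sigma> * avg \<Omega> (X - S) (\<lambda>\<psi>.
      weight (covered_edges H {X} - covered_edges H {S}) (override_on \<sigma> \<psi> (X - S)) *
      h (restrict (override_on \<sigma> \<psi> (X - S)) S)))"
      by (rule avg_split[OF H fin(3) SX(1)])
    also have "\<dots> = avg \<Omega> S (\<lambda>\<sigma>. weight (covered_edges H {S}) \<sigma> *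
        (extension_weight H S X \<sigma> * h \<sigma>))"
    proof (intro avg_cong arg_cong2[where f = "(*)"] refl)
      fix \<sigma> assume "\<sigma> \<in> S \<rightarrow>\<^sub>E \<Omega>"
      then have "restrict (override_on \<sigma> \<psi> (X - S)) S = \<sigma>" for \<psi>
        by (auto simp: fun_eq_iff override_on_def restrict_def PiE_def extensional_def)
      then show "avg \<Omega> (X - S) (\<lambda>\<psi>.
          weight (covered_edges H {X} - covered_edges H {S}) (override_on \<sigma> \<psi> (X - S)) *
          h (restrict (override_on \<sigma> \<psi> (X - S)) S)) = extension_weight H S X \<sigma> * h \<sigma>"
        by (simp add: extension_weight_def avg_cmult[symmetric] mult.commute)
    qed
    also have "extension_weight H S X = g"
      unfolding g_def S_def using extension_weight_iso[OF H _ Y iso fixed] sub X by blast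
    finally show ?thesis .
  qed
  \<comment> \<open>The factor \<open>g\<close> in the law on the separator cancels the conditional
    normaliser, leaving the weighted distribution on \<open>Y\<close>.\<close>
  have new: "avg \<Omega> (V \<union> D) (\<lambda>\<phi>. weight (covered_edges H (insert Y P)) \<phi> / G' \<phi> * h (restrict \<phi> Y)) =
      avg \<Omega> Y (\<lambda>\<phi>. weight (covered_edges H {Y}) \<phi> * h \<phi>)" for h
  proof -
    define k where "k = (\<lambda>\<sigma>. avg \<Omega> D (\<lambda>\<psi>. weight L (override_on \<sigma> \<psi> D) * h (override_on \<sigma> \<psi> D)))"
    have "avg \<Omega> (V \<union> D) (\<lambda>\<phi>. weight (covered_edges H (insert Y P)) \<phi> / G' \<phi> * h (restrict \<phi> Y)) =
        avg \<Omega> V (\<lambda>\<phi>. \<nu> \<phi> * (k (restrict \<phi> S) / g (restrict \<phi> S)))"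
      unfolding star k_def by (intro avg_cong arg_cong2[where f = "(*)"] arg_cong2[where f = "(/)"] refl)
        (simp add: rY)
    also have "\<dots> = avg \<Omega> S (\<lambda>\<sigma>. weight (covered_edges H {S}) \<sigma> * (g \<sigma> * (k \<sigma> / g \<sigma>)))"
      by (rule sep)
    also have "\<dots> = avg \<Omega> S (\<lambda>\<sigma>. weight (covered_edges H {S}) \<sigma> * k \<sigma>)"
      by (simp add: gne)
    also have "\<dots> = avg \<Omega> Y (\<lambda>\<phi>. weight (covered_edges H {Y}) \<phi> * h \<phi>)"
      unfolding k_def L_def D_def by (rule avg_split[OF H fin(2) SX(3), symmetric])
    finally show ?thesis .
  qed
  have "0 \<le> avg \<Omega> (V \<union> D) (\<lambda>\<phi>. weight (covered_edges H (insert Y P)) \<phi> / G' \<phi> * ln (G' \<phi>))"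
  proof -
    \<comment> \<open>The expectation of \<open>ln g\<close> is the average of
      \<open>weight * g * ln g\<close> over \<open>S\<close>. Since
      \<open>g * ln g \<ge> g - 1\<close>, it is at least the total mass one computed here minus the
      density of the separator, hence nonnegative.\<close>
    have gl: "avg \<Omega> S (\<lambda>\<sigma>. weight (covered_edges H {S}) \<sigma> * (g \<sigma> * 1)) = 1"
      unfolding sep[symmetric] using marg[OF X, of "\<lambda>_. 1"] total by (simp add: \<nu>_def)
    have "0 \<le> avg \<Omega> S (\<lambda>\<sigma>. weight (covered_edges H {S}) \<sigma> * (g \<sigma> * 1)) -
        avg \<Omega> S (weight (covered_edges H {S}))"
      using gl separator by (simp add: S_def)
    also have "\<dots> = avg \<Omega> S (\<lambda>\<sigma>. weight (covered_edges H {S}) \<sigma> * (g \<sigma> - 1))"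
      by (simp add: avg_diff[symmetric] algebra_simps)
    also have "\<dots> \<le> avg \<Omega> S (\<lambda>\<sigma>. weight (covered_edges H {S}) \<sigma> * (g \<sigma> * ln (g \<sigma>)))"
    proof (intro avg_mono mult_left_mono less_imp_le[OF weight_pos])
      fix \<sigma>
      have "ln (1 / g \<sigma>) \<le> 1 / g \<sigma> - 1" using gpos by (intro ln_le_minus_one) simp
      then show "g \<sigma> - 1 \<le> g \<sigma> * ln (g \<sigma>)" using gpos[of \<sigma>] by (simp add: ln_div field_simps)
    qed
    finally have 1: "0 \<le> avg \<Omega> V (\<lambda>\<phi>. \<nu> \<phi> * ln (g (restrict \<phi> S)))"
      by (subst sep[of "\<lambda>\<sigma>. ln (g \<sigma>)"])
    \<comment> \<open>The logarithm of \<open>G'\<close> depends on old values only, so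
      \<open>old\<close> evaluates its expectation.\<close>
    have "avg \<Omega> (V \<union> D) (\<lambda>\<phi>. weight (covered_edges H (insert Y P)) \<phi> / G' \<phi> * ln (G' \<phi>)) =
        avg \<Omega> (V \<union> D) (\<lambda>\<phi>. weight (covered_edges H (insert Y P)) \<phi> / G' \<phi> *
          (\<lambda>\<tau>. ln (G \<tau>) + ln (g (restrict \<tau> S))) (restrict \<phi> V))"
    proof (intro avg_cong)
      fix \<phi> assume \<phi>: "\<phi> \<in> (V \<union> D) \<rightarrow>\<^sub>E \<Omega>"
      have "restrict \<phi> V \<in> V \<rightarrow>\<^sub>E \<Omega>" using \<phi> by auto
      moreover have "restrict (restrict \<phi> V) S = restrict \<phi> S" using SX by (simp add: Int_absorb1)
      ultimately have "ln (G' \<phi>) = (\<lambda>\<tau>. ln (G \<tau>) + ln (g (restrict \<tau> S))) (restrict \<phi> V)"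
        using G gpos by (simp add: G'_def ln_mult_pos)
      then show "weight (covered_edges H (insert Y P)) \<phi> / G' \<phi> * ln (G' \<phi>) =
          weight (covered_edges H (insert Y P)) \<phi> / G' \<phi> *
          (\<lambda>\<tau>. ln (G \<tau>) + ln (g (restrict \<tau> S))) (restrict \<phi> V)" by (simp only:)
    qed
    also have "\<dots> = avg \<Omega> V (\<lambda>\<phi>. \<nu> \<phi> * ln (G \<phi>)) + avg \<Omega> V (\<lambda>\<phi>. \<nu> \<phi> * ln (g (restrict \<phi> S)))"
      by (subst old) (simp add: distrib_left avg_add)
    finally show ?thesis using 1 ent by (simp add: \<nu>_def)
  qed
  moreover have "avg \<Omega> (V \<union> D) (\<lambda>\<phi>. weight (covered_edges H (insert Y P)) \<phi> / G' \<phi> * h (restrict \<phi> Z)) =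
      avg \<Omega> Z (\<lambda>\<phi>. weight (covered_edges H {Z}) \<phi> * h \<phi>)" if "Z \<in> insert Y P" for Z h
  proof (cases "Z = Y")
    case True
    then show ?thesis using new by simp
  next
    case False
    then have Z: "Z \<in> P" "Z \<subseteq> V" using that by (auto simp: V_def)
    have "avg \<Omega> (V \<union> D) (\<lambda>\<phi>. weight (covered_edges H (insert Y P)) \<phi> / G' \<phi> * h (restrict \<phi> Z)) =
        avg \<Omega> (V \<union> D) (\<lambda>\<phi>. weight (covered_edges H (insert Y P)) \<phi> / G' \<phi> *
          h (restrict (restrict \<phi> V) Z))"
      using Z by (simp add: Int_absorb1)
    also have "\<dots> = avg \<Omega> V (\<lambda>\<phi>. \<nu> \<phi> * h (restrict \<phi> Z))" by (rule old)
    finally show ?thesis using marg[OF Z(1)] by (simp add: \<nu>_def)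
  qed
  moreover have "0 < G' \<phi>" if "\<phi> \<in> (V \<union> D) \<rightarrow>\<^sub>E \<Omega>" for \<phi>
    using that unfolding G'_def by (intro mult_pos_pos G gpos) auto
  ultimately show ?thesis
    using VD(2) by (intro exI[of _ G'] gluingI) (simp_all only:)
qed

text \<open>The weight is \<open>G\<close> times the density of the random map, so its average is
  the expectation of \<open>G\<close>. The bound \<open>G \<ge> 1 + ln G\<close> reduces this to the
  total mass and the nonnegative expectation of \<open>ln G\<close>.\<close>

lemma gluing_imp_one_le_avg:
  assumes glued: "gluing H P G" and P: "finite (\<Union>P)" "X \<in> P"
    and total: "avg \<Omega> X (weight (covered_edges H {X})) = 1"
  shows "1 \<le> avg \<Omega> (\<Union>P) (weight (covered_edges H P))"
proof -
  let ?V = "\<Union>P" and ?w = "weight (covered_edges H P)"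
  note G = gluingD(1)[OF glued]
  have one: "avg \<Omega> ?V (\<lambda>\<phi>. ?w \<phi> / G \<phi>) = 1"
    using gluingD(2)[OF glued P(2), of "\<lambda>_. 1"] total by simp
  have "1 \<le> avg \<Omega> ?V (\<lambda>\<phi>. ?w \<phi> / G \<phi> + ?w \<phi> / G \<phi> * ln (G \<phi>))"
    using gluingD(3)[OF glued] one by (simp add: avg_add)
  also have "\<dots> \<le> avg \<Omega> ?V ?w"
  proof (rule avg_mono)
    fix \<phi> assume "\<phi> \<in> ?V \<rightarrow>\<^sub>E \<Omega>"
    then have g: "0 < G \<phi>" by (rule G)
    have "?w \<phi> / G \<phi> * (1 + ln (G \<phi>)) \<le> ?w \<phi> / G \<phi> * G \<phi>"
      using ln_le_minus_one[OF g] g weight_pos[of "covered_edges H P" \<phi>] by (intro mult_left_mono) auto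
    then show "?w \<phi> / G \<phi> + ?w \<phi> / G \<phi> * ln (G \<phi>) \<le> ?w \<phi>"
      using g by (simp add: distrib_left)
  qed
  finally show ?thesis .
qed

text \<open>Transfers the density of a separator inside a bag to a subgraph of \<open>N\<close>. The
  average may run over the whole bag, since vertices outside \<open>S\<close> meet none of the edges
  involved and average out.\<close>

lemma avg_iso_subset:
  fixes H :: "'a ugraph" and N :: "'v ugraph"
  assumes iso: "graph_iso \<zeta> (induced_subgraph H X) N"
    and H: "simple_graph H" "X \<subseteq> vertices H" and N: "simple_graph N" and S: "S \<subseteq> X"
  shows "avg \<Omega> S (weight (covered_edges H {S})) =
    avg \<Omega> (vertices N) (weight ((`) \<zeta> ` covered_edges H {S}))"
proof -
  have bij: "bij_betw \<zeta> X (vertices N)" using iso by (simp add: graph_iso_def induced_subgraph_def)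
  have finX: "finite X" using H finite_subset by (auto simp: simple_graph_def)
  have "inj_on ((`) \<zeta>) (covered_edges H {X})"
    using graph_iso_inj_edges[OF iso] simple_graph_induced[OF H] by (simp add: edges_induced_subgraph)
  then have inj: "inj_on ((`) \<zeta>) (covered_edges H {S})"
    by (rule inj_on_subset) (use S in \<open>auto simp: covered_edges_def\<close>)
  have loc: "weight (covered_edges H {S}) \<phi> = weight (covered_edges H {S}) \<psi>"
    if "\<And>v. v \<in> S \<Longrightarrow> \<phi> v = \<psi> v" for \<phi> \<psi> :: "'a \<Rightarrow> 'c"
    by (rule edge_weight_cong) (use that in \<open>auto simp: covered_edges_def\<close>)
  have "avg \<Omega> S (weight (covered_edges H {S})) =
      avg \<Omega> X (\<lambda>\<phi>. weight (covered_edges H {S}) (restrict \<phi> S))"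
    by (rule avg_restrict[symmetric]) (use finite_target nonempty_target finX S in auto)
  also have "\<dots> = avg \<Omega> X (weight (covered_edges H {S}))"
    by (intro avg_cong loc) simp
  also have "\<dots> = avg \<Omega> (vertices N) (\<lambda>\<psi>. weight (covered_edges H {S}) (restrict (\<psi> \<circ> \<zeta>) X))"
    by (rule avg_bij[OF bij])
  also have "\<dots> = avg \<Omega> (vertices N) (weight ((`) \<zeta> ` covered_edges H {S}))"
    unfolding edge_weight_image[OF inj] by (intro avg_cong loc) (use S in auto)
  finally show ?thesis .
qed

text \<open>Bags are glued in the order given by \<open>connected_graph_induct\<close>. The
  isomorphism of each bag with \<open>N\<close> turns \<open>total\<close> into its normalisation
  and \<open>sub\<close> into the bound for its separators.\<close>

lemma one_le_avg_decomposition: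
  fixes N :: "'v ugraph" and H :: "'a ugraph"
  assumes N: "simple_graph N" and H: "simple_graph H" and dec: "N_decomposition N H F T"
    and total: "avg \<Omega> (vertices N) (weight (edges N)) = 1"
    and sub: "\<And>K. K \<subseteq> edges N \<Longrightarrow> avg \<Omega> (vertices N) (weight K) \<le> 1"
  shows "1 \<le> avg \<Omega> (vertices H) (weight (edges H))"
proof -
  have td: "tree_decomposition H F T" using dec by (simp add: N_decomposition_def)
  have F: "\<And>X. X \<in> F \<Longrightarrow> X \<subseteq> vertices H" "\<Union>F = vertices H" "vertices T = F"
    and conn: "connected_graph T" and finF: "finite F"
    and path: "\<And>X Y Z p. X \<in> F \<Longrightarrow> Y \<in> F \<Longrightarrow> path_between T X Y p \<Longrightarrow> Z \<in> set p \<Longrightarrow> X \<inter> Y \<subseteq> Z"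
    using td by (auto simp: tree_decomposition_def tree_def simple_graph_def)
  have finH: "finite (vertices H)" using H by (simp add: simple_graph_def)
  have tot: "avg \<Omega> X (weight (covered_edges H {X})) = 1"
    and sep: "\<And>S. S \<subseteq> X \<Longrightarrow> avg \<Omega> S (weight (covered_edges H {S})) \<le> 1" if X: "X \<in> F" for X
  proof -
    obtain \<zeta> where iso: "graph_iso \<zeta> (induced_subgraph H X) N"
      using dec X by (auto simp: N_decomposition_def isomorphic_def)
    have E: "edges N = (`) \<zeta> ` covered_edges H {X}"
      using graph_iso_edges[OF iso simple_graph_induced[OF H F(1)[OF X]] N]
      by (simp add: edges_induced_subgraph)
    show "avg \<Omega> X (weight (covered_edges H {X})) = 1"
      using avg_iso_subset[OF iso H F(1)[OF X] N subset_refl] total E by simp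
    fix S assume S: "S \<subseteq> X"
    then have "(`) \<zeta> ` covered_edges H {S} \<subseteq> edges N" unfolding E
      by (intro image_mono) (auto simp: covered_edges_def)
    then show "avg \<Omega> S (weight (covered_edges H {S})) \<le> 1"
      using avg_iso_subset[OF iso H F(1)[OF X] N S] sub by simp
  qed
  have "\<exists>G. gluing H (vertices T) G"
  proof (rule connected_graph_induct[OF conn])
    show "finite (vertices T)" using F finF by simp
    show "\<exists>G. gluing H {X} G" if "X \<in> vertices T" for X
      using gluing_singleton[OF finite_subset[OF F(1) finH]] that F(3) by blast
  next
    fix P X Y
    assume P: "P \<subseteq> vertices T" "\<exists>G. gluing H P G" "X \<in> P" "Y \<in> vertices T - P" "{X, Y} \<in> edges T"
      and paths: "\<And>Z. Z \<in> P \<Longrightarrow> \<exists>p. path_between T Y Z p \<and> X \<in> set p"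
    have FF: "X \<in> F" "Y \<in> F" "\<And>Z. Z \<in> P \<Longrightarrow> Z \<in> F" using P F by auto
    obtain \<zeta> where iso: "graph_iso \<zeta> (induced_subgraph H X) (induced_subgraph H Y)"
      and fixed: "\<And>v. v \<in> X \<inter> Y \<Longrightarrow> \<zeta> v = v"
      using dec FF P(5) unfolding N_decomposition_def by blast
    \<comment> \<open>Some path from \<open>Y\<close> to the old bag \<open>Z\<close> passes through
      \<open>X\<close>, so the intersection axiom puts their common vertices into
      \<open>X\<close>.\<close>
    have "Y \<inter> Z \<subseteq> X" if "Z \<in> P" for Z
      using paths[OF that] path[OF FF(2) FF(3)[OF that]] by blast
    then have meet: "Y \<inter> \<Union>P = X \<inter> Y" using P(3) by blast
    obtain G where G: "gluing H P G" using P(2) by blast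
    show "\<exists>G. gluing H (insert Y P) G"
      by (rule gluing_insert[OF H F(1)[OF FF(3)] F(1)[OF FF(2)] G P(3) meet iso fixed tot[OF FF(1)] sep[OF FF(1)]])
        auto
  qed
  then obtain G where "gluing H F G" using F by auto
  moreover obtain X where "X \<in> F" using conn F(3) by (auto simp: connected_graph_def)
  ultimately have "1 \<le> avg \<Omega> (\<Union>F) (weight (covered_edges H F))"
    using F finH tot by (intro gluing_imp_one_le_avg) auto
  moreover have "covered_edges H F = edges H"
    using td by (auto simp: covered_edges_def tree_decomposition_def)
  ultimately show ?thesis using F by simp
qed

end


section \<open>Tensor powers\<close>

text \<open>A step of the tensor square is a pair \<open>(i, j)\<close> coded as the number
  \<open>i * n + j\<close>; \<open>div\<close> and \<open>mod\<close> are the two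
  projections.\<close>

definition tensor_square :: "nat \<Rightarrow> (nat set \<Rightarrow> real) \<Rightarrow> nat set \<Rightarrow> real" where
  "tensor_square n \<alpha> S = \<alpha> ((\<lambda>i. i div n) ` S) * \<alpha> ((\<lambda>i. i mod n) ` S)"

lemma sum_PiE_product:
  fixes F :: "('v \<Rightarrow> nat) \<Rightarrow> real"
  assumes "0 < n"
  shows "(\<Sum>\<phi> \<in> V \<rightarrow>\<^sub>E {..<n * n}. F (\<lambda>v\<in>V. \<phi> v div n) * F (\<lambda>v\<in>V. \<phi> v mod n)) =
    (\<Sum>\<phi> \<in> V \<rightarrow>\<^sub>E {..<n}. F \<phi>) ^ 2"
proof -
  let ?j = "\<lambda>\<phi>. (\<lambda>v\<in>V. \<phi> v div n, \<lambda>v\<in>V. \<phi> v mod n)"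
  let ?i = "\<lambda>(\<phi>, \<psi>). \<lambda>v\<in>V. \<phi> v * n + \<psi> v"
  have "(\<Sum>\<phi> \<in> V \<rightarrow>\<^sub>E {..<n * n}. F (\<lambda>v\<in>V. \<phi> v div n) * F (\<lambda>v\<in>V. \<phi> v mod n)) =
      (\<Sum>(\<phi>, \<psi>) \<in> (V \<rightarrow>\<^sub>E {..<n}) \<times> (V \<rightarrow>\<^sub>E {..<n}). F \<phi> * F \<psi>)"
  proof (rule sum.reindex_bij_witness[where j = ?j and i = ?i])
    fix \<phi> assume \<phi>: "\<phi> \<in> V \<rightarrow>\<^sub>E {..<n * n}"
    show "?i (?j \<phi>) = \<phi>" using \<phi> by (auto simp: fun_eq_iff restrict_def PiE_def extensional_def)
    have "\<phi> v div n < n" if "v \<in> V" for v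
      using \<phi> that by (intro less_mult_imp_div_less) auto
    then show "?j \<phi> \<in> (V \<rightarrow>\<^sub>E {..<n}) \<times> (V \<rightarrow>\<^sub>E {..<n})" using assms by auto
    show "(case ?j \<phi> of (\<phi>, \<psi>) \<Rightarrow> F \<phi> * F \<psi>) = F (\<lambda>v\<in>V. \<phi> v div n) * F (\<lambda>v\<in>V. \<phi> v mod n)"
      by simp
  next
    fix p assume p: "p \<in> (V \<rightarrow>\<^sub>E {..<n}) \<times> (V \<rightarrow>\<^sub>E {..<n})"
    obtain \<phi> \<psi> where [simp]: "p = (\<phi>, \<psi>)" by (cases p)
    have lt: "\<phi> v < n" "\<psi> v < n" if "v \<in> V" for v using p that by auto
    then have "(\<phi> v * n + \<psi> v) div n = \<phi> v" "(\<phi> v * n + \<psi> v) mod n = \<psi> v" if "v \<in> V" for v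
      using that assms by simp_all
    then show "?j (?i p) = p"
      using p by (auto simp: fun_eq_iff restrict_def PiE_def extensional_def)
    have "\<phi> v * n + \<psi> v < n * n" if "v \<in> V" for v
    proof -
      have "\<phi> v * n + \<psi> v < Suc (\<phi> v) * n" using lt[OF that] by simp
      also have "\<dots> \<le> n * n" using lt[OF that] by (intro mult_le_mono1) simp
      finally show ?thesis .
    qed
    then show "?i p \<in> V \<rightarrow>\<^sub>E {..<n * n}" by auto
  qed
  then show ?thesis
    by (simp add: sum.cartesian_product[symmetric] power2_eq_square sum_product)
qed

lemma avg_tensor_square:
  assumes "0 < n" "\<And>e. e \<in> K \<Longrightarrow> e \<subseteq> V"
  shows "avg {..<n * n} V (edge_weight (tensor_square n \<alpha>) K) = (avg {..<n} V (edge_weight \<alpha> K)) ^ 2"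
proof -
  have "edge_weight (tensor_square n \<alpha>) K \<phi> =
      edge_weight \<alpha> K (\<lambda>v\<in>V. \<phi> v div n) * edge_weight \<alpha> K (\<lambda>v\<in>V. \<phi> v mod n)" for \<phi>
    unfolding edge_weight_def tensor_square_def image_image prod.distrib
    using assms(2) by (intro arg_cong2[where f = "(*)"] prod.cong refl arg_cong[where f = \<alpha>]
        image_cong) auto
  then show ?thesis
    unfolding avg_def using sum_PiE_product[OF assms(1), of "edge_weight \<alpha> K" V]
    by (simp add: power_mult_distrib power_divide power2_eq_square)
qed

text \<open>A single target serves all \<open>K\<close> at once, so that the densities of a subgraph
  and of the whole graph can be compared on it. Repeated squaring reaches the exponents
  \<open>2 ^ k\<close>, which are unbounded and hence enough.\<close>

lemma avg_tensor_power:
  fixes n :: nat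
  assumes "0 < n" "\<And>S. 0 \<le> \<alpha> S"
  shows "\<exists>(n' :: nat) \<alpha>'. 0 < n' \<and> (\<forall>S. 0 \<le> \<alpha>' S) \<and> (\<forall>K. (\<forall>e\<in>K. e \<subseteq> V) \<longrightarrow>
    avg {..<n'} V (edge_weight \<alpha>' K) = (avg {..<n} V (edge_weight \<alpha> K)) ^ (2 ^ k))"
proof (induction k)
  case 0
  then show ?case using assms by (intro exI[of _ n] exI[of _ \<alpha>]) auto
next
  case (Suc k)
  then obtain n' :: nat and \<alpha>' where *: "0 < n'" "\<forall>S. 0 \<le> \<alpha>' S" "\<forall>K. (\<forall>e\<in>K. e \<subseteq> V) \<longrightarrow>
    avg {..<n'} V (edge_weight \<alpha>' K) = (avg {..<n} V (edge_weight \<alpha> K)) ^ (2 ^ k)"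
    by (elim exE conjE) (rule that)
  have "0 \<le> tensor_square n' \<alpha>' S" for S using * by (simp add: tensor_square_def)
  then show ?case
    using * by (intro exI[of _ "n' * n'"] exI[of _ "tensor_square n' \<alpha>'"])
      (auto simp: avg_tensor_square power_mult[symmetric] mult.commute)
qed

text \<open>Comparing the \<open>K\<close>-density of a tensor power with the norm of that power plus one loses
  only a constant factor, which disappears as the power grows.\<close>

lemma avg_subgraph_le_1:
  fixes n :: nat
  assumes V: "finite V" and E: "finite E" "E \<noteq> {}" "\<And>e. e \<in> E \<Longrightarrow> e \<subseteq> V" and K: "K \<subseteq> E"
    and triangle: "\<And>n \<alpha> \<beta>. 0 < n \<Longrightarrow> (\<And>S. 0 \<le> \<alpha> S) \<Longrightarrow> (\<And>S. 0 \<le> \<beta> S) \<Longrightarrow>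
      avg {..<n::nat} V (edge_weight (\<lambda>S. \<alpha> S + \<beta> S) E) powr (1 / card E) \<le>
      avg {..<n} V (edge_weight \<alpha> E) powr (1 / card E) +
      avg {..<n} V (edge_weight \<beta> E) powr (1 / card E)"
    and n: "0 < n" and nonneg: "\<And>S. 0 \<le> \<alpha> S"
    and total: "avg {..<n} V (edge_weight \<alpha> E) = 1"
  shows "avg {..<n} V (edge_weight \<alpha> K) \<le> 1"
proof (rule ccontr)
  let ?c = "avg {..<n} V (edge_weight \<alpha> K)" and ?m = "card E"
  assume "\<not> ?c \<le> 1"
  then have c: "1 < ?c" by simp
  have m: "0 < ?m" using E by (simp add: card_gt_0_iff)
  \<comment> \<open>The triangle inequality will allow a norm of at most \<open>1 + 1\<close>, whose
    power with exponent \<open>?m\<close> is \<open>2 ^ ?m\<close>; the tensor power is chosen to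
    exceed this.\<close>
  obtain k where k: "2 ^ ?m < ?c ^ k" using real_arch_pow[OF c] by blast
  obtain n' :: nat and \<beta> where n': "0 < n'" and "\<forall>S. 0 \<le> \<beta> S"
    and "\<forall>L. (\<forall>e\<in>L. e \<subseteq> V) \<longrightarrow>
      avg {..<n'} V (edge_weight \<beta> L) = (avg {..<n} V (edge_weight \<alpha> L)) ^ (2 ^ k)"
    using avg_tensor_power[where \<alpha> = \<alpha>, OF n nonneg, of V k] by (elim exE conjE) (rule that)
  then have \<beta>: "\<And>S. 0 \<le> \<beta> S"
    and pow: "\<And>L. (\<forall>e\<in>L. e \<subseteq> V) \<Longrightarrow>
      avg {..<n'} V (edge_weight \<beta> L) = (avg {..<n} V (edge_weight \<alpha> L)) ^ (2 ^ k)" by simp_all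
  \<comment> \<open>Adding one makes every factor at least one, so a product over \<open>K\<close>
    can be completed to a product over \<open>E\<close> without decreasing.\<close>
  let ?B = "avg {..<n'} V (edge_weight (\<lambda>S. \<beta> S + 1) E)"
  have "?c ^ k \<le> ?c ^ (2 ^ k)" using c by (intro power_increasing) (auto intro: less_imp_le less_exp)
  also have "\<dots> = avg {..<n'} V (edge_weight \<beta> K)" using pow[of K] E(3)[OF subsetD[OF K]] by simp
  also have "\<dots> \<le> ?B"
  proof (rule avg_mono)
    fix \<phi> :: "'a \<Rightarrow> nat"
    have "edge_weight \<beta> K \<phi> \<le> edge_weight (\<lambda>S. \<beta> S + 1) K \<phi>"
      unfolding edge_weight_def by (intro prod_mono) (simp add: \<beta>)
    also have "\<dots> \<le> edge_weight (\<lambda>S. \<beta> S + 1) E \<phi>"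
      unfolding edge_weight_def
      by (intro prod_mono2 E K) (auto simp: \<beta> add_nonneg_nonneg)
    finally show "edge_weight \<beta> K \<phi> \<le> edge_weight (\<lambda>S. \<beta> S + 1) E \<phi>" .
  qed
  finally have B: "?c ^ k \<le> ?B" .
  then have Bpos: "0 < ?B" using c by (smt (verit) zero_less_power)
  have "avg {..<n'} V (edge_weight (\<lambda>_. 1) E) = avg {..<n'} V (\<lambda>_. 1)"
    by (rule avg_cong) (simp add: edge_weight_def)
  then have "avg {..<n'} V (edge_weight (\<lambda>_. 1) E) = 1"
    using n' V by (simp add: avg_const lessThan_empty_iff)
  moreover have "avg {..<n'} V (edge_weight \<beta> E) = 1" using pow E total by simp
  ultimately have "?B powr (1 / ?m) \<le> 2" using triangle[OF n', of \<beta> "\<lambda>_. 1"] \<beta> by simp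
  then have "(?B powr (1 / ?m)) ^ ?m \<le> 2 ^ ?m" by (intro power_mono) auto
  moreover have "(?B powr (1 / ?m)) ^ ?m = ?B"
    using m Bpos by (simp add: powr_realpow[symmetric] powr_powr)
  ultimately show False using B k by simp
qed


section \<open>Step functions and product measures\<close>

text \<open>The steps are the intervals \<open>(j / n, (j + 1) / n]\<close>, and truncated
  subtraction puts \<open>0\<close> into the first one. Closing them on the right keeps
  \<open>x = 1\<close> in step \<open>n - 1\<close>.\<close>

definition grid :: "nat \<Rightarrow> real \<Rightarrow> nat" where
  "grid n x = nat \<lceil>real n * x\<rceil> - 1"

definition step_function :: "nat \<Rightarrow> (nat set \<Rightarrow> real) \<Rightarrow> real \<times> real \<Rightarrow> real" where
  "step_function n \<alpha> p = \<alpha> {grid n (fst p), grid n (snd p)}"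

definition cell :: "nat \<Rightarrow> nat \<Rightarrow> real set" where
  "cell n j = {x \<in> {0..1}. grid n x = j}"

abbreviation unit_measure :: "real measure" where
  "unit_measure \<equiv> restrict_space lborel {0..1}"

section \<open>Cells of the grid and the uniform measure on the cube\<close>

lemma grid_less: "0 < n \<Longrightarrow> x \<in> {0..1} \<Longrightarrow> grid n x < n"
proof -
  assume n: "0 < n" and x: "x \<in> {0..1}"
  have "real n * x \<le> real n" using x by (simp add: mult_left_le)
  then have "\<lceil>real n * x\<rceil> \<le> int n" by (simp add: ceiling_le_iff)
  then show ?thesis using n by (auto simp: grid_def)
qed

lemma grid_approx:
  assumes "0 < n" "x \<in> {0..1}"
  shows "\<bar>real (grid n x) / real n - x\<bar> \<le> 1 / real n"
\<comment> \<open>At \<open>x = 0\<close> the subtraction in \<open>grid\<close> truncates; for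
  positive \<open>x\<close> the ceiling is at least one and the difference is exact.\<close>
proof (cases "x = 0")
  case False
  then have "0 < real n * x" using assms by auto
  then have "1 \<le> \<lceil>real n * x\<rceil>" by linarith
  then have "real (grid n x) = of_int \<lceil>real n * x\<rceil> - 1" unfolding grid_def by linarith
  then have "\<bar>real (grid n x) - real n * x\<bar> \<le> 1" by linarith
  then have "\<bar>real (grid n x) - real n * x\<bar> / real n \<le> 1 / real n" by (intro divide_right_mono) auto
  moreover have "\<bar>real (grid n x) - real n * x\<bar> / real n = \<bar>(real (grid n x) - real n * x) / real n\<bar>"
    by simp
  moreover have "(real (grid n x) - real n * x) / real n = real (grid n x) / real n - x"
    using assms by (simp add: field_simps)
  ultimately show ?thesis by simp
qed (simp add: grid_def)

lemma measurable_grid [measurable]: "grid n \<in> measurable borel (count_space UNIV)"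
  unfolding grid_def by measurable

lemma cell_eq:
  assumes "j < n"
  shows "cell n j = (if j = 0 then {0..1 / n} else {j / n<..Suc j / n})"
proof -
  have n: "0 < real n" using assms by simp
  have iff: "grid n x = j \<longleftrightarrow> (if j = 0 then real n * x \<le> 1 else j < real n * x \<and> real n * x \<le> Suc j)"
    if "0 \<le> x" for x
  proof -
    \<comment> \<open>For \<open>j = 0\<close> truncation merges the ceilings \<open>0\<close> and
      \<open>1\<close>.\<close>
    have "grid n x = j \<longleftrightarrow> (if j = 0 then \<lceil>real n * x\<rceil> \<le> 1 else \<lceil>real n * x\<rceil> = int j + 1)"
      unfolding grid_def by (cases "j = 0"; simp; linarith)
    also have "\<dots> \<longleftrightarrow> (if j = 0 then real n * x \<le> 1 else j < real n * x \<and> real n * x \<le> Suc j)"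
      by (auto simp: ceiling_le_iff ceiling_eq_iff)
    finally show ?thesis .
  qed
  have jn: "real (Suc j) \<le> real n" using assms by simp
  show ?thesis
  proof (intro set_eqI)
    fix x
    have le1: "x \<le> 1" if "real n * x \<le> real n" using that n by simp
    show "x \<in> cell n j \<longleftrightarrow> x \<in> (if j = 0 then {0..1 / n} else {j / n<..Suc j / n})"
    proof (cases "0 \<le> x")
      case True
      have "x \<le> 1" if "real n * x \<le> Suc j" using that jn le1 by linarith
      then show ?thesis using True iff[OF True] n
        by (auto simp: cell_def field_simps split: if_splits)
    next
      case False
      then have "\<not> j / n < x" using n by (meson divide_nonneg_pos less_trans not_le of_nat_0_le_iff order.strict_trans1)
      then show ?thesis using False by (auto simp: cell_def)
    qed
  qed
qed

lemma cell_subset: "cell n j \<subseteq> {0..1}"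
  by (auto simp: cell_def)

lemma sets_cell [measurable]: "cell n j \<in> sets borel"
  unfolding cell_def by measurable

lemma emeasure_cell:
  assumes "j < n"
  shows "emeasure lborel (cell n j) = ennreal (1 / n)"
  unfolding cell_eq[OF assms] using assms
  by (auto simp: field_simps)

lemma sets_cell_unit: "cell n j \<in> sets unit_measure"
  using cell_subset by (auto simp: sets_restrict_space_iff)

lemma measurable_unit_id [measurable]: "(\<lambda>x. x) \<in> measurable unit_measure borel"
  by (simp add: measurable_restrict_space1)

lemma emeasure_unit: "emeasure unit_measure {0..1} = 1"
  by (subst emeasure_restrict_space) auto

lemma finite_measure_unit: "finite_measure unit_measure"
  by (rule finite_measureI) (simp add: space_restrict_space emeasure_unit)

lemma product_sigma_finite_unit: "product_sigma_finite (\<lambda>_. unit_measure)"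
  unfolding product_sigma_finite_def using finite_measure_unit by (simp add: finite_measure_def)

lemma space_unit: "space unit_measure = {0..1}"
  by (simp add: space_restrict_space)

lemma finite_measure_cube:
  assumes "finite V"
  shows "finite_measure (cube_measure V)"
proof -
  interpret product_sigma_finite "\<lambda>_. unit_measure" by (rule product_sigma_finite_unit)
  have sets: "{0..1} \<in> sets unit_measure" using sets.top[of unit_measure] by (simp add: space_unit)
  have "emeasure (\<Pi>\<^sub>M i\<in>V. unit_measure) (V \<rightarrow>\<^sub>E {0..1}) = 1"
    by (subst emeasure_PiM[OF assms sets]) (simp add: emeasure_unit)
  moreover have "V \<rightarrow>\<^sub>E {0..1} \<in> sets (\<Pi>\<^sub>M i\<in>V. unit_measure)"
    by (intro sets_PiM_I_finite assms sets)
  ultimately show ?thesis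
    by (intro finite_measureI) (simp add: cube_measure_def space_PiM space_unit)
qed

text \<open>For a uniform point of the cube the grid indices are independent and uniform on
  \<open>{..<n}\<close>: the cube splits into boxes of cells, each of measure
  \<open>(1 / n) ^ card V\<close>.\<close>

lemma has_bochner_integral_grid:
  assumes V: "finite V" and n: "0 < n"
  shows "has_bochner_integral (\<Pi>\<^sub>M i\<in>V. unit_measure) (\<lambda>x. F (\<lambda>v\<in>V. grid n (x v))) (avg {..<n} V F)"
proof -
  let ?P = "\<Pi>\<^sub>M i\<in>V. unit_measure"
  interpret product_sigma_finite "\<lambda>_. unit_measure" by (rule product_sigma_finite_unit)
  let ?A = "\<lambda>\<phi>. \<Pi>\<^sub>E v\<in>V. cell n (\<phi> v)"
  have A: "?A \<phi> \<in> sets ?P" for \<phi> using V sets_cell_unit by (intro sets_PiM_I_finite) auto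
  have "emeasure ?P (?A \<phi>) = ennreal ((1 / n) ^ card V)" if \<phi>: "\<phi> \<in> V \<rightarrow>\<^sub>E {..<n}" for \<phi>
  proof -
    have "emeasure ?P (?A \<phi>) = (\<Prod>v\<in>V. emeasure unit_measure (cell n (\<phi> v)))"
      using V sets_cell_unit by (intro emeasure_PiM) auto
    also have "\<dots> = (\<Prod>v\<in>V. ennreal (1 / n))"
    proof (rule prod.cong)
      fix v assume "v \<in> V"
      then have "\<phi> v < n" using \<phi> by auto
      then show "emeasure unit_measure (cell n (\<phi> v)) = ennreal (1 / n)"
        using emeasure_cell cell_subset by (subst emeasure_restrict_space) auto
    qed simp
    finally show ?thesis by (simp add: ennreal_power)
  qed
  then have "has_bochner_integral ?P (indicator (?A \<phi>)) ((1 / n) ^ card V)" if "\<phi> \<in> V \<rightarrow>\<^sub>E {..<n}" for \<phi>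
    using has_bochner_integral_real_indicator[OF A, of \<phi>] that by (simp add: measure_def)
  then have "has_bochner_integral ?P (\<lambda>x. indicator (?A \<phi>) x * F \<phi>) ((1 / n) ^ card V * F \<phi>)"
    if "\<phi> \<in> V \<rightarrow>\<^sub>E {..<n}" for \<phi>
    using that by (intro has_bochner_integral_mult_left) auto
  then have "has_bochner_integral ?P (\<lambda>x. \<Sum>\<phi>\<in>V \<rightarrow>\<^sub>E {..<n}. indicator (?A \<phi>) x * F \<phi>)
      (\<Sum>\<phi>\<in>V \<rightarrow>\<^sub>E {..<n}. (1 / n) ^ card V * F \<phi>)"
    by (intro has_bochner_integral_sum) auto
  moreover have "(\<Sum>\<phi>\<in>V \<rightarrow>\<^sub>E {..<n}. indicator (?A \<phi>) x * F \<phi>) = F (\<lambda>v\<in>V. grid n (x v))"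
    if "x \<in> space ?P" for x
  proof -
    have x: "x v \<in> {0..1}" if "v \<in> V" for v
      using \<open>x \<in> space ?P\<close> that by (auto simp: space_PiM space_unit PiE_def Pi_def)
    have ext: "x \<in> extensional V" using that by (auto simp: space_PiM PiE_def)
    have "indicator (?A \<phi>) x * F \<phi> = (if \<phi> = (\<lambda>v\<in>V. grid n (x v)) then F \<phi> else 0)"
      if "\<phi> \<in> V \<rightarrow>\<^sub>E {..<n}" for \<phi>
    proof -
      have "x \<in> ?A \<phi> \<longleftrightarrow> (\<forall>v\<in>V. grid n (x v) = \<phi> v)"
        using x ext by (auto simp: PiE_def Pi_def cell_def)
      also have "\<dots> \<longleftrightarrow> \<phi> = (\<lambda>v\<in>V. grid n (x v))"
        using that by (auto simp: fun_eq_iff PiE_def extensional_def)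
      finally show ?thesis by (simp add: indicator_def)
    qed
    then have "(\<Sum>\<phi>\<in>V \<rightarrow>\<^sub>E {..<n}. indicator (?A \<phi>) x * F \<phi>) =
        (\<Sum>\<phi>\<in>V \<rightarrow>\<^sub>E {..<n}. if \<phi> = (\<lambda>v\<in>V. grid n (x v)) then F \<phi> else 0)"
      by (intro sum.cong) auto
    also have "\<dots> = F (\<lambda>v\<in>V. grid n (x v))"
      using V x grid_less[OF n] by (simp add: finite_PiE)
    finally show ?thesis .
  qed
  moreover have "(\<Sum>\<phi>\<in>V \<rightarrow>\<^sub>E {..<n}. (1 / n) ^ card V * F \<phi>) = avg {..<n} V F"
    by (simp add: avg_def sum_distrib_left[symmetric] sum_divide_distrib[symmetric] power_divide)
  ultimately show ?thesis
    using has_bochner_integral_cong[of ?P ?P "\<lambda>x. \<Sum>\<phi>\<in>V \<rightarrow>\<^sub>E {..<n}. indicator (?A \<phi>) x * F \<phi>"]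
    by auto
qed

text \<open>As the parts are disjoint, each edge has exactly one orientation from \<open>A\<close>
  to \<open>B\<close>. For factors that depend on the edge as a set, the bipartition thus
  disappears.\<close>

lemma prod_bipartition:
  assumes "bipartition G A B"
  shows "(\<Prod>(i, j)\<in>{(i, j). i \<in> A \<and> j \<in> B \<and> {i, j} \<in> edges G}. h {i, j}) = (\<Prod>e\<in>edges G. h e)"
proof -
  let ?S = "{(i, j). i \<in> A \<and> j \<in> B \<and> {i, j} \<in> edges G}"
  have "bij_betw (\<lambda>(i, j). {i, j}) ?S (edges G)"
    unfolding bij_betw_def
  proof
    show "inj_on (\<lambda>(i, j). {i, j}) ?S"
      using assms by (auto simp: inj_on_def bipartition_def doubleton_eq_iff)
    show "(\<lambda>(i, j). {i, j}) ` ?S = edges G"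
      using assms by (auto simp: bipartition_def image_iff)
  qed
  from prod.reindex_bij_betw[OF this, of h] show ?thesis
    by (simp add: case_prod_unfold)
qed

text \<open>The passage from integrals to finite averages. The integrand is already measurable for
  the product measure, so the completion does not change its integral.\<close>

lemma hom_density_step:
  assumes G: "simple_graph G" "bipartition G A B" and n: "0 < n"
  shows "hom_density G A B (step_function n \<alpha>) = avg {..<n} (vertices G) (edge_weight \<alpha> (edges G))"
proof -
  let ?P = "\<Pi>\<^sub>M i\<in>vertices G. unit_measure"
  have V: "finite (vertices G)" using G by (simp add: simple_graph_def)
  have eq: "(\<Prod>(i, j)\<in>{(i, j). i \<in> A \<and> j \<in> B \<and> {i, j} \<in> edges G}. step_function n \<alpha> (x i, x j)) =
      edge_weight \<alpha> (edges G) (\<lambda>v\<in>vertices G. grid n (x v))" for x :: "'a \<Rightarrow> real"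
  proof -
    have "(\<Prod>(i, j)\<in>{(i, j). i \<in> A \<and> j \<in> B \<and> {i, j} \<in> edges G}. step_function n \<alpha> (x i, x j)) =
      edge_weight \<alpha> (edges G) (\<lambda>v. grid n (x v))"
      using prod_bipartition[OF G(2), of "\<lambda>e. \<alpha> ((\<lambda>v. grid n (x v)) ` e)"]
      by (simp add: edge_weight_def step_function_def)
    also have "\<dots> = edge_weight \<alpha> (edges G) (\<lambda>v\<in>vertices G. grid n (x v))"
      by (rule edge_weight_cong) (use simple_graph_edge_subset[OF G(1)] in auto)
    finally show ?thesis .
  qed
  have "has_bochner_integral ?P (\<lambda>x. edge_weight \<alpha> (edges G) (\<lambda>v\<in>vertices G. grid n (x v)))
      (avg {..<n} (vertices G) (edge_weight \<alpha> (edges G)))"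
    by (rule has_bochner_integral_grid[OF V n])
  then show ?thesis
    unfolding hom_density_def cube_measure_def eq
    by (subst integral_completion) (auto simp: has_bochner_integral_iff)
qed

section \<open>Step functions on the square, and measurability of functions of two
  coordinates\<close>

lemma measurable_step_function [measurable]: "step_function n \<alpha> \<in> borel_measurable borel"
proof -
  have "(\<lambda>p::real \<times> real. (grid n (fst p), grid n (snd p))) \<in>
      measurable (borel \<Otimes>\<^sub>M borel) (count_space UNIV \<Otimes>\<^sub>M count_space UNIV)"
    by measurable
  then have "(\<lambda>p::real \<times> real. (grid n (fst p), grid n (snd p))) \<in> measurable borel (count_space UNIV)"
    by (simp add: borel_prod pair_measure_countable)
  from measurable_compose[OF this, of "\<lambda>(i, j). \<alpha> {i, j}" borel]
  show ?thesis by (simp add: step_function_def[abs_def])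
qed

lemma measurable_lebesgue_on: "g \<in> borel_measurable borel \<Longrightarrow> g \<in> borel_measurable (lebesgue_on S)"
  by (intro measurable_restrict_space1 measurable_completion) simp

lemma step_function_bounded_measurable:
  assumes "0 < n"
  shows "step_function n \<alpha> \<in> bounded_measurable"
proof -
  have "\<bar>step_function n \<alpha> p\<bar> \<le> (\<Sum>(i, j)\<in>{..<n} \<times> {..<n}. \<bar>\<alpha> {i, j}\<bar>)" if "p \<in> unit_square" for p
    using that grid_less[OF assms]
      member_le_sum[of "(grid n (fst p), grid n (snd p))" "{..<n} \<times> {..<n}" "\<lambda>(i, j). \<bar>\<alpha> {i, j}\<bar>"]
    by (auto simp: step_function_def)
  then show ?thesis
    by (auto simp: bounded_measurable_def intro: measurable_lebesgue_on)
qed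

lemma integral_step_function:
  assumes n: "0 < n"
  shows "(\<integral>p. step_function n \<alpha> p \<partial>lebesgue_on unit_square) =
    (\<Sum>i<n. \<Sum>j<n. \<alpha> {i, j}) / real n ^ 2"
proof -
  have sq: "unit_square \<in> sets borel" by (intro borel_closed closed_Times) auto
  have cells: "cell n i \<times> cell n j \<in> sets borel" for i j
    by (metis borel_prod pair_measureI sets_cell)
  have "emeasure lborel (cell n i \<times> cell n j) = ennreal (1 / n ^ 2)" if "i < n" "j < n" for i j
  proof -
    have "emeasure (lborel \<Otimes>\<^sub>M lborel) (cell n i \<times> cell n j) =
        emeasure lborel (cell n i) * emeasure lborel (cell n j)"
      by (intro lborel.emeasure_pair_measure_Times) auto
    then show ?thesis
      using that by (simp add: lborel_prod emeasure_cell ennreal_mult[symmetric] power2_eq_square)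
  qed
  then have "has_bochner_integral lborel (indicator (cell n i \<times> cell n j)) (1 / real (n ^ 2))"
    if "i < n" "j < n" for i j
    using has_bochner_integral_real_indicator[of "cell n i \<times> cell n j" lborel] cells that
    by (simp add: measure_def)
  then have "has_bochner_integral lborel (\<lambda>p. indicator (cell n i \<times> cell n j) p * \<alpha> {i, j})
      (1 / n ^ 2 * \<alpha> {i, j})" if "i < n" "j < n" for i j
    using that by (intro has_bochner_integral_mult_left) auto
  then have sum: "has_bochner_integral lborel
      (\<lambda>p. \<Sum>i<n. \<Sum>j<n. indicator (cell n i \<times> cell n j) p * \<alpha> {i, j})
      (\<Sum>i<n. \<Sum>j<n. 1 / n ^ 2 * \<alpha> {i, j})"
    by (intro has_bochner_integral_sum) auto
  have "(\<Sum>i<n. \<Sum>j<n. indicator (cell n i \<times> cell n j) p * \<alpha> {i, j}) =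
      indicator unit_square p *\<^sub>R step_function n \<alpha> p" for p
  proof (cases "p \<in> unit_square")
    case True
    have "indicator (cell n i \<times> cell n j) p =
        (if i = grid n (fst p) then 1 else 0) * (if j = grid n (snd p) then 1 else (0::real))" for i j
      using True by (auto simp: indicator_def cell_def mem_Times_iff)
    then have "(\<Sum>j<n. indicator (cell n i \<times> cell n j) p * \<alpha> {i, j}) =
        (if i = grid n (fst p) then step_function n \<alpha> p else 0)" for i
      using True grid_less[OF n, of "snd p"]
      by (simp add: step_function_def mem_Times_iff if_distrib[of "\<lambda>x. x * _"] cong: if_cong)
    then show ?thesis using True grid_less[OF n, of "fst p"] by (simp add: mem_Times_iff)
  next
    case False
    have "indicator (cell n i \<times> cell n j) p = (0::real)" for i j
      using False cell_subset[of n i] cell_subset[of n j] by (auto simp: indicator_def)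
    then show ?thesis using False by simp
  qed
  with sum have "has_bochner_integral lborel (\<lambda>p. indicator unit_square p *\<^sub>R step_function n \<alpha> p)
      (\<Sum>i<n. \<Sum>j<n. 1 / n ^ 2 * \<alpha> {i, j})" by simp
  then have "integral\<^sup>L lebesgue (\<lambda>p. indicator unit_square p *\<^sub>R step_function n \<alpha> p) =
      (\<Sum>i<n. \<Sum>j<n. 1 / n ^ 2 * \<alpha> {i, j})"
    using sq by (subst integral_completion) (auto simp: has_bochner_integral_iff)
  moreover have "(\<integral>p. step_function n \<alpha> p \<partial>lebesgue_on unit_square) =
      integral\<^sup>L lebesgue (\<lambda>p. indicator unit_square p *\<^sub>R step_function n \<alpha> p)"
    using sq by (subst integral_restrict_space) auto
  ultimately show ?thesis by (simp add: sum_divide_distrib)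
qed

text \<open>By Tonelli, the joint law of two distinct coordinates is dominated by planar Lebesgue
  measure, so planar null sets pull back to null sets of the cube.\<close>

lemma AE_cube_pair_notin:
  assumes V: "finite V" "i \<in> V" "j \<in> V" "i \<noteq> j" and N: "N \<in> null_sets lborel"
  shows "AE x in (\<Pi>\<^sub>M i\<in>V. unit_measure). (x i, x j) \<notin> N"
proof -
  interpret product_sigma_finite "\<lambda>_. unit_measure" by (rule product_sigma_finite_unit)
  interpret unit: finite_measure unit_measure by (rule finite_measure_unit)
  \<comment> \<open>The coordinates \<open>i\<close> and \<open>j\<close> are split off to be
    integrated first; the integral over those in \<open>W\<close> is then one of the constant
    zero.\<close>
  define W where "W = V - {i, j}"
  have VW: "V = insert i (insert j W)" and W: "finite W" "i \<notin> insert j W" "j \<notin> W"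
    using V by (auto simp: W_def)
  have Nb: "N \<in> sets (borel \<Otimes>\<^sub>M borel)" using null_setsD2[OF N] unfolding borel_prod by simp
  note [measurable] = Nb
  have Nm [measurable]: "(\<lambda>(y, z). indicator N (y, z) :: ennreal) \<in> borel_measurable (borel \<Otimes>\<^sub>M borel)"
    by measurable
  have mc [measurable]: "(\<lambda>x. x k) \<in> borel_measurable (\<Pi>\<^sub>M i\<in>U. unit_measure)" if "k \<in> U" for k U
    using measurable_compose[OF measurable_component_singleton[OF that] measurable_unit_id] by simp
  define h where "h z = (\<integral>\<^sup>+y. indicator N (y, z) \<partial>unit_measure)" for z
  have hm: "h \<in> borel_measurable borel"
    unfolding h_def by measurable
  have "(\<integral>\<^sup>+x. indicator N (x i, x j) \<partial>(\<Pi>\<^sub>M i\<in>V. unit_measure)) =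
      (\<integral>\<^sup>+x. \<integral>\<^sup>+y. indicator N ((x(i := y)) i, (x(i := y)) j) \<partial>unit_measure \<partial>(\<Pi>\<^sub>M i\<in>insert j W. unit_measure))"
    unfolding VW by (intro product_nn_integral_insert) (use W in \<open>auto intro!: measurable_compose[OF measurable_Pair Nm[unfolded case_prod_eta]] mc\<close>)
  also have "\<dots> = (\<integral>\<^sup>+x. h (x j) \<partial>(\<Pi>\<^sub>M i\<in>insert j W. unit_measure))"
    using V by (simp add: h_def)
  also have "\<dots> = (\<integral>\<^sup>+x. \<integral>\<^sup>+z. h ((x(j := z)) j) \<partial>unit_measure \<partial>(\<Pi>\<^sub>M i\<in>W. unit_measure))"
    by (intro product_nn_integral_insert) (use W in \<open>auto intro!: measurable_compose[OF mc hm]\<close>)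
  also have "\<dots> = (\<integral>\<^sup>+x. (\<integral>\<^sup>+z. h z \<partial>unit_measure) \<partial>(\<Pi>\<^sub>M i\<in>W. unit_measure))" by simp
  also have "(\<integral>\<^sup>+z. h z \<partial>unit_measure) = 0"
  proof -
    have le: "(\<integral>\<^sup>+z. g z \<partial>unit_measure) \<le> (\<integral>\<^sup>+z. g z \<partial>lborel)" for g
      by (subst nn_integral_restrict_space) (auto intro!: nn_integral_mono simp: indicator_def)
    have "(\<integral>\<^sup>+z. h z \<partial>unit_measure) \<le> (\<integral>\<^sup>+z. h z \<partial>lborel)" by (rule le)
    also have "\<dots> \<le> (\<integral>\<^sup>+z. \<integral>\<^sup>+y. indicator N (y, z) \<partial>lborel \<partial>lborel)"
      unfolding h_def by (intro nn_integral_mono le)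
    also have "\<dots> = (\<integral>\<^sup>+p. indicator N p \<partial>(lborel \<Otimes>\<^sub>M lborel))"
      by (subst lborel_pair.nn_integral_snd[symmetric]) (use N in \<open>auto simp: lborel_prod\<close>)
    also have "\<dots> = 0" using N by (simp add: lborel_prod null_sets_def)
    finally show ?thesis by simp
  qed
  finally have "(\<integral>\<^sup>+x. indicator N (x i, x j) \<partial>(\<Pi>\<^sub>M i\<in>V. unit_measure)) = 0" by simp
  then have "AE x in (\<Pi>\<^sub>M i\<in>V. unit_measure). indicator N (x i, x j) = (0::ennreal)"
    using V by (subst (asm) nn_integral_0_iff_AE) (auto intro!: measurable_compose[OF measurable_Pair Nm[unfolded case_prod_eta]] mc)
  then show ?thesis by eventually_elim (auto simp: indicator_def split: if_splits)
qed

text \<open>Since \<open>f\<close> is only Lebesgue measurable, Borel measurability of the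
  projection to two coordinates does not suffice: preimages of null sets must be null as well, which
  \<open>AE_cube_pair_notin\<close> provides.\<close>

lemma measurable_cube_pair:
  fixes f :: "real \<times> real \<Rightarrow> real"
  assumes V: "finite V" "i \<in> V" "j \<in> V" "i \<noteq> j"
    and f: "f \<in> borel_measurable (lebesgue_on unit_square)"
  shows "(\<lambda>x. f (x i, x j)) \<in> borel_measurable (cube_measure V)"
proof -
  let ?P = "\<Pi>\<^sub>M i\<in>V. unit_measure"
  have mc: "(\<lambda>x. x k) \<in> borel_measurable ?P" if "k \<in> V" for k
    using measurable_compose[OF measurable_component_singleton[OF that] measurable_unit_id] by simp
  have pair: "(\<lambda>x. (x i, x j)) \<in> measurable ?P lborel"
    using mc V by (simp add: borel_measurable_Pair)
  have "(\<lambda>x. (x i, x j)) \<in> measurable (cube_measure V) lebesgue"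
    unfolding cube_measure_def
  proof (rule completion.measurable_completion2)
    show pair': "(\<lambda>x. (x i, x j)) \<in> measurable (completion ?P) lborel"
      by (rule measurable_completion[OF pair])
    show "null_sets lborel \<subseteq> null_sets (distr (completion ?P) lborel (\<lambda>x. (x i, x j)))"
    proof
      fix N :: "(real \<times> real) set" assume N: "N \<in> null_sets lborel"
      have "AE x in completion ?P. (x i, x j) \<notin> N"
        by (intro AE_completion AE_cube_pair_notin V N)
      moreover have S: "(\<lambda>x. (x i, x j)) -` N \<inter> space ?P \<in> sets (completion ?P)"
        using measurable_sets[OF pair', of N] N by auto
      ultimately have "(\<lambda>x. (x i, x j)) -` N \<inter> space ?P \<in> null_sets (completion ?P)"
        by (subst AE_iff_null_sets[OF S]) auto
      then show "N \<in> null_sets (distr (completion ?P) lborel (\<lambda>x. (x i, x j)))"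
        using N pair' by (subst null_sets_distr_iff) auto
    qed
  qed
  \<comment> \<open>Extended by zero, \<open>f\<close> is measurable on the whole plane, and
    coordinate pairs of points of the cube never leave the square.\<close>
  moreover have "(\<lambda>p. indicator unit_square p *\<^sub>R f p) \<in> borel_measurable lebesgue"
    using f by (subst (asm) borel_measurable_restrict_space_iff) (auto simp: borel_closed closed_Times)
  ultimately have "(\<lambda>x. indicator unit_square (x i, x j) *\<^sub>R f (x i, x j)) \<in> borel_measurable (cube_measure V)"
    by (rule measurable_compose)
  moreover have "(x i, x j) \<in> unit_square" if "x \<in> space (cube_measure V)" for x
    using that V by (auto simp: cube_measure_def space_PiM space_unit PiE_def Pi_def)
  ultimately show ?thesis by (subst measurable_cong[where g = "\<lambda>x. indicator unit_square (x i, x j) *\<^sub>R f (x i, x j)"]) auto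
qed


section \<open>Approximation by step functions\<close>

text \<open>Dominated convergence on the cube. Convergence off \<open>Z\<close> becomes convergence
  almost everywhere, because each of the finitely many edges pulls a null set back to a null
  set.\<close>

lemma hom_density_tendsto:
  assumes G: "simple_graph G" "bipartition G A B"
    and meas: "\<And>k. s k \<in> borel_measurable (lebesgue_on unit_square)"
      "f \<in> borel_measurable (lebesgue_on unit_square)"
    and bound: "\<And>k p. p \<in> unit_square \<Longrightarrow> \<bar>s k p\<bar> \<le> C"
    and Z: "negligible Z" and lim: "\<And>p. p \<in> unit_square - Z \<Longrightarrow> (\<lambda>k. s k p) \<longlonglongrightarrow> f p"
  shows "(\<lambda>k. hom_density G A B (s k)) \<longlonglongrightarrow> hom_density G A B f"
proof -
  let ?S = "{(i, j). i \<in> A \<and> j \<in> B \<and> {i, j} \<in> edges G}" and ?M = "cube_measure (vertices G)"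
  have V: "finite (vertices G)" using G by (simp add: simple_graph_def)
  have S: "i \<in> vertices G" "j \<in> vertices G" "i \<noteq> j" if "(i, j) \<in> ?S" for i j
    using that G(2) by (auto simp: bipartition_def)
  have finS: "finite ?S"
    by (rule finite_subset[of _ "vertices G \<times> vertices G"]) (use S V in auto)
  have sq: "(x i, x j) \<in> unit_square" if "(i, j) \<in> ?S" "x \<in> space ?M" for x i j
    using S[OF that(1)] that(2) by (auto simp: cube_measure_def space_PiM space_unit PiE_def Pi_def)
  \<comment> \<open>\<open>Z\<close> is enlarged to a Borel null set, the form in which
    \<open>AE_cube_pair_notin\<close> applies.\<close>
  obtain N where N: "N \<in> null_sets lborel" "Z \<subseteq> N"
    using Z by (auto simp: negligible_iff_null_sets null_sets_completion_iff2)
  have "AE x in ?M. (x i, x j) \<notin> N" if "(i, j) \<in> ?S" for i j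
    unfolding cube_measure_def by (intro AE_completion AE_cube_pair_notin V S[OF that] N)
  then have ae: "AE x in ?M. \<forall>(i, j)\<in>?S. (x i, x j) \<notin> N"
    using finS by (intro AE_finite_allI) auto
  have m: "(\<lambda>x. \<Prod>(i, j)\<in>?S. g (x i, x j)) \<in> borel_measurable ?M"
    if "g \<in> borel_measurable (lebesgue_on unit_square)" for g :: "real \<times> real \<Rightarrow> real"
    unfolding case_prod_unfold
    by (rule borel_measurable_prod) (use S V that in \<open>auto intro!: measurable_cube_pair\<close>)
  interpret finite_measure ?M by (rule finite_measure_cube[OF V])
  show ?thesis
    unfolding hom_density_def
  proof (rule integral_dominated_convergence[where w = "\<lambda>_. C ^ card ?S"])
    show "(\<lambda>x. \<Prod>(i, j)\<in>?S. f (x i, x j)) \<in> borel_measurable ?M"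
      and "(\<lambda>x. \<Prod>(i, j)\<in>?S. s k (x i, x j)) \<in> borel_measurable ?M" for k
      using m meas by auto
    show "integrable ?M (\<lambda>_. C ^ card ?S)" by simp
    show "AE x in ?M. (\<lambda>k. \<Prod>(i, j)\<in>?S. s k (x i, x j)) \<longlonglongrightarrow> (\<Prod>(i, j)\<in>?S. f (x i, x j))"
      using ae AE_space
    proof eventually_elim
      case (elim x)
      then show ?case
        unfolding case_prod_unfold
        by (intro tendsto_prod lim) (use sq N(2) in auto)
    qed
    show "AE x in ?M. norm (\<Prod>(i, j)\<in>?S. s k (x i, x j)) \<le> C ^ card ?S" for k
      using AE_space
    proof eventually_elim
      case (elim x)
      have "norm (\<Prod>(i, j)\<in>?S. s k (x i, x j)) = (\<Prod>p\<in>?S. \<bar>s k (x (fst p), x (snd p))\<bar>)"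
        by (simp add: case_prod_unfold abs_prod)
      also have "\<dots> \<le> (\<Prod>p\<in>?S. C)"
        by (intro prod_mono) (use sq elim bound in auto)
      finally show ?case by simp
    qed
  qed
qed

lemma integral_square_tendsto:
  fixes f :: "real \<times> real \<Rightarrow> real"
  assumes meas: "\<And>k. s k \<in> borel_measurable (lebesgue_on unit_square)"
      "f \<in> borel_measurable (lebesgue_on unit_square)"
    and bound: "\<And>k p. p \<in> unit_square \<Longrightarrow> \<bar>s k p\<bar> \<le> C"
    and Z: "negligible Z" and lim: "\<And>p. p \<in> unit_square - Z \<Longrightarrow> (\<lambda>k. s k p) \<longlonglongrightarrow> f p"
  shows "(\<lambda>k. \<integral>p. s k p \<partial>lebesgue_on unit_square) \<longlonglongrightarrow> (\<integral>p. f p \<partial>lebesgue_on unit_square)"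
proof (rule integral_dominated_convergence[where w = "\<lambda>_. C"])
  have sq: "unit_square = cbox (0, 0) (1, 1)" by (auto simp: cbox_Pair_eq)
  show "integrable (lebesgue_on unit_square) (\<lambda>_. C)"
    unfolding sq by (intro finite_measure.integrable_const finite_measure_lebesgue_on lmeasurable_cbox)
  have "AE p in lebesgue. p \<notin> Z" using Z by (simp add: negligible_iff_null_sets AE_not_in)
  then have "AE p in lebesgue_on unit_square. p \<notin> Z"
    unfolding sq by (subst AE_restrict_space_iff) auto
  then show "AE p in lebesgue_on unit_square. (\<lambda>k. s k p) \<longlonglongrightarrow> f p"
    using AE_space by eventually_elim (use lim in \<open>auto simp: space_restrict_space\<close>)
  show "AE p in lebesgue_on unit_square. norm (s k p) \<le> C" for k
    using AE_space by eventually_elim (use bound in \<open>auto simp: space_restrict_space\<close>)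
qed (use meas in auto)

lemma grid_mono: "x \<le> y \<Longrightarrow> grid n x \<le> grid n y"
  unfolding grid_def by (intro diff_le_mono nat_mono ceiling_mono mult_left_mono) auto

lemma negligible_swap:
  fixes N :: "(real \<times> real) set"
  assumes "negligible N"
  shows "negligible (prod.swap ` N)"
proof (rule negligible_differentiable_image_negligible[OF _ assms])
  have "linear (prod.swap :: real \<times> real \<Rightarrow> _)" by (intro linearI) auto
  then show "prod.swap differentiable_on N" by (rule linear_imp_differentiable_on)
qed simp

text \<open>A measurable function is almost everywhere a limit of continuous ones, and these are
  uniformly continuous on the square, so sampling on a fine grid changes them little. Symmetry comes
  from sampling only at points with ordered coordinates, positivity from adding a vanishing
  constant.\<close>

lemma step_function_approximation:
  assumes f: "f \<in> bounded_measurable" "\<And>p. p \<in> unit_square \<Longrightarrow> 0 \<le> f p"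
    and sym: "\<And>x y. x \<in> {0..1} \<Longrightarrow> y \<in> {0..1} \<Longrightarrow> f (x, y) = f (y, x)"
  obtains n \<alpha> C Z where "\<And>k::nat. 0 < n k" "\<And>k S. 0 < \<alpha> k S"
    "\<And>k p. p \<in> unit_square \<Longrightarrow> \<bar>step_function (n k) (\<alpha> k) p\<bar> \<le> C" "negligible Z"
    "\<And>p. p \<in> unit_square - Z \<Longrightarrow> (\<lambda>k. step_function (n k) (\<alpha> k) p) \<longlonglongrightarrow> f p"
proof -
  obtain C where C: "\<And>p. p \<in> unit_square \<Longrightarrow> \<bar>f p\<bar> \<le> C"
    and fm: "f \<in> borel_measurable (lebesgue_on unit_square)"
    using f(1) by (auto simp: bounded_measurable_def)
  have C0: "0 \<le> C" using C[of "(0, 0)"] by auto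
  have sqb: "unit_square \<in> sets lebesgue" by (simp add: borel_closed closed_Times)
  have "(\<lambda>p. indicator unit_square p *\<^sub>R f p) \<in> borel_measurable lebesgue"
    using fm sqb by (subst (asm) borel_measurable_restrict_space_iff) auto
  then have "(\<lambda>p. indicator unit_square p *\<^sub>R f p) measurable_on unit_square"
    using sqb by (rule lebesgue_measurable_imp_measurable_on_real)
  then obtain N g where N: "negligible N" and g: "\<And>k::nat. continuous_on UNIV (g k)"
    and glim: "\<And>p. p \<notin> N \<Longrightarrow>
      (\<lambda>k. g k p) \<longlonglongrightarrow> (if p \<in> unit_square then indicator unit_square p *\<^sub>R f p else 0)"
    unfolding measurable_on_def by blast
  \<comment> \<open>Truncation supplies the uniform bound and nonnegativity; the limit is unaffected
    because \<open>0 \<le> f \<le> C\<close> on the square.\<close>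
  define h where "h k p = max 0 (min C (g k p))" for k p
  have h: "0 \<le> h k p" "h k p \<le> C" for k p using C0 by (auto simp: h_def)
  have hcont: "continuous_on unit_square (h k)" for k
    unfolding h_def by (intro continuous_intros continuous_on_subset[OF g]) auto
  have hlim: "(\<lambda>k. h k p) \<longlonglongrightarrow> f p" if p: "p \<in> unit_square" "p \<notin> N" for p
  proof -
    have "(\<lambda>k. g k p) \<longlonglongrightarrow> f p" using glim[OF p(2)] p(1) by simp
    then have "(\<lambda>k. h k p) \<longlonglongrightarrow> max 0 (min C (f p))" unfolding h_def by (intro tendsto_intros)
    moreover have "max 0 (min C (f p)) = f p" using C[OF p(1)] f(2)[OF p(1)] by auto
    ultimately show ?thesis by simp
  qed
  have "\<exists>n>0. \<forall>x\<in>{0..1}. \<forall>y\<in>{0..1}.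
    \<bar>h k (grid n x / n, grid n y / n) - h k (x, y)\<bar> < 1 / Suc k" for k
  proof -
    have "uniformly_continuous_on unit_square (h k)"
      by (intro compact_uniformly_continuous hcont compact_Times) auto
    then obtain \<delta> where \<delta>: "\<delta> > 0" "\<And>p q. p \<in> unit_square \<Longrightarrow> q \<in> unit_square \<Longrightarrow> dist q p < \<delta> \<Longrightarrow>
        dist (h k q) (h k p) < 1 / Suc k"
      by (rule uniformly_continuous_onE[where \<epsilon> = "1 / Suc k"]) auto
    \<comment> \<open>Each coordinate moves by at most \<open>1 / n\<close> when it is replaced by
      its grid point, hence the pair by at most \<open>2 / n < \<delta>\<close>.\<close>
    obtain n where n: "0 < n" "2 / \<delta> < real n"
      by (metis less_trans of_nat_0_less_iff reals_Archimedean2 \<delta>(1) divide_pos_pos zero_less_numeral)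
    have "\<bar>h k (grid n x / n, grid n y / n) - h k (x, y)\<bar> < 1 / Suc k" if xy: "x \<in> {0..1}" "y \<in> {0..1}" for x y
    proof -
      have "dist (grid n x / n, grid n y / n) (x, y) \<le> dist (grid n x / n) x + dist (grid n y / n) y"
        by (simp add: dist_Pair_Pair sqrt_sum_squares_le_sum)
      also have "\<dots> \<le> 1 / n + 1 / n"
        using grid_approx[OF n(1) xy(1)] grid_approx[OF n(1) xy(2)] by (simp add: dist_real_def)
      also have "\<dots> < \<delta>" using n \<delta>(1) by (simp add: field_simps)
      finally have "dist (grid n x / n, grid n y / n) (x, y) < \<delta>" .
      moreover have "(grid n x / n, grid n y / n) \<in> unit_square"
        using grid_less[OF n(1) xy(1)] grid_less[OF n(1) xy(2)] n by (simp add: field_simps)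
      ultimately show ?thesis using \<delta>(2) xy by (simp add: dist_real_def)
    qed
    then show ?thesis using n by blast
  qed
  then obtain n where n: "\<And>k. 0 < n k"
    and close: "\<And>k x y. x \<in> {0..1} \<Longrightarrow> y \<in> {0..1} \<Longrightarrow>
      \<bar>h k (grid (n k) x / n k, grid (n k) y / n k) - h k (x, y)\<bar> < 1 / Suc k"
    by metis
  \<comment> \<open>A set argument cannot tell \<open>(x, y)\<close> from \<open>(y, x)\<close>.
    \<open>Min\<close> and \<open>Max\<close> select the ordered sample, which for
    \<open>x \<le> y\<close> is the right one because \<open>grid\<close> is monotone; the summand
    \<open>1 / Suc k\<close> ensures positivity.\<close>
  define \<alpha> where "\<alpha> k S = h k (real (Min S) / n k, real (Max S) / n k) + 1 / Suc k" for k S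
  have pos: "0 < \<alpha> k S" for k S using h(1) by (simp add: \<alpha>_def add_nonneg_pos)
  have le: "\<alpha> k S \<le> C + 1" for k S
    unfolding \<alpha>_def by (intro add_mono h) (simp add: field_simps)
  have ord: "(\<lambda>k. step_function (n k) (\<alpha> k) (x, y)) \<longlonglongrightarrow> f (x, y)"
    if "x \<in> {0..1}" "y \<in> {0..1}" "x \<le> y" "(x, y) \<notin> N" for x y
  proof -
    have "step_function (n k) (\<alpha> k) (x, y) = h k (grid (n k) x / n k, grid (n k) y / n k) + 1 / Suc k" for k
      using grid_mono[OF that(3), of "n k"]
      by (simp add: step_function_def \<alpha>_def min_absorb1 max_absorb2)
    \<comment> \<open>One \<open>1 / Suc k\<close> is the sampling error, the other the added
      constant.\<close>
    then have "\<bar>step_function (n k) (\<alpha> k) (x, y) - h k (x, y)\<bar> \<le> 2 / Suc k" for k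
      using close[OF that(1,2), of k] by (simp del: of_nat_Suc)
    then have "\<forall>\<^sub>F k in sequentially.
        norm (step_function (n k) (\<alpha> k) (x, y) - h k (x, y)) \<le> 2 / real (Suc k)"
      by (intro always_eventually allI) (simp only: real_norm_def)
    moreover have "(\<lambda>k. 2 / real (Suc k)) \<longlonglongrightarrow> 0"
      by (rule LIMSEQ_Suc[OF lim_const_over_n])
    ultimately have "(\<lambda>k. step_function (n k) (\<alpha> k) (x, y) - h k (x, y)) \<longlonglongrightarrow> 0"
      by (rule Lim_null_comparison)
    from tendsto_add[OF this hlim[of "(x, y)"]] that show ?thesis by simp
  qed
  show ?thesis
  \<comment> \<open>Below the diagonal, convergence is taken from the reflected point, so the
    reflected point has to avoid \<open>N\<close> too.\<close>
  proof (rule that[of n \<alpha> "C + 1" "N \<union> prod.swap ` N"])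
    show "\<bar>step_function (n k) (\<alpha> k) p\<bar> \<le> C + 1" for k p
      using pos le by (simp add: step_function_def abs_of_pos)
    show "negligible (N \<union> prod.swap ` N)"
      by (intro negligible_Un N negligible_swap)
    fix p assume p: "p \<in> unit_square - (N \<union> prod.swap ` N)"
    obtain x y where [simp]: "p = (x, y)" by (cases p)
    have xy: "x \<in> {0..1}" "y \<in> {0..1}" "(x, y) \<notin> N" "(y, x) \<notin> N" using p by force+
    show "(\<lambda>k. step_function (n k) (\<alpha> k) p) \<longlonglongrightarrow> f p"
    proof (cases "x \<le> y")
      case True
      then show ?thesis using ord xy by simp
    next
      case False
      then have "(\<lambda>k. step_function (n k) (\<alpha> k) (y, x)) \<longlonglongrightarrow> f (y, x)" using ord xy by simp
      then show ?thesis using sym xy by (simp add: step_function_def insert_commute)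
    qed
  qed (use n pos in auto)
qed


section \<open>Sidorenko's property\<close>

text \<open>The density of a one-edge subgraph, with the other vertices averaged out, is the
  integral of the step function as given by \<open>integral_step_function\<close>. This is how the
  edge density enters as a subgraph density of \<open>N\<close>.\<close>

lemma avg_edge:
  fixes n :: nat
  assumes V: "finite V" "u \<in> V" "v \<in> V" "u \<noteq> v" and n: "0 < n"
  shows "avg {..<n} V (edge_weight \<alpha> {{u, v}}) = (\<Sum>i<n. \<Sum>j<n. \<alpha> {i, j}) / real n ^ 2"
proof -
  have single: "avg {..<n} {w} F = (\<Sum>i<n. F (\<lambda>_\<in>{w}. i)) / n" for w :: 'a and F
    unfolding avg_def
    by (subst sum.reindex_bij_witness[where j = "\<lambda>\<phi>. \<phi> w" and i = "\<lambda>i. \<lambda>_\<in>{w}. i" and T = "{..<n}"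
          and h = "\<lambda>i. F (\<lambda>_\<in>{w}. i)"])
      (auto simp: PiE_def extensional_def fun_eq_iff intro!: arg_cong[where f = F])
  have "avg {..<n} V (edge_weight \<alpha> {{u, v}}) =
      avg {..<n} V (\<lambda>\<phi>. edge_weight \<alpha> {{u, v}} (restrict \<phi> {u, v}))"
    by (simp add: edge_weight_def[abs_def])
  also have "\<dots> = avg {..<n} ({u} \<union> {v}) (edge_weight \<alpha> {{u, v}})"
    using V n by (subst avg_restrict) (auto simp: insert_commute)
  also have "\<dots> = avg {..<n} {u} (\<lambda>\<phi>. avg {..<n} {v} (\<lambda>\<psi>. edge_weight \<alpha> {{u, v}} (override_on \<phi> \<psi> {v})))"
    by (rule avg_Un) (use V in auto)
  also have "\<dots> = (\<Sum>i<n. \<Sum>j<n. \<alpha> {i, j}) / real n ^ 2"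
    using V by (simp add: single edge_weight_def sum_divide_distrib power2_eq_square)
  finally show ?thesis .
qed

lemma avg_edge_weight_scale:
  "avg \<Omega> V (edge_weight (\<lambda>S. \<alpha> S / c) K) = avg \<Omega> V (edge_weight \<alpha> K) / c ^ card K"
  by (simp add: avg_def edge_weight_def prod_dividef sum_divide_distrib[symmetric])

lemma r_norm_step:
  fixes n :: nat
  assumes N: "simple_graph N" "bipartition N A B" and n: "0 < n" and \<alpha>: "\<And>S. 0 \<le> \<alpha> S"
  shows "r_norm N A B (step_function n \<alpha>) =
    avg {..<n} (vertices N) (edge_weight \<alpha> (edges N)) powr (1 / card (edges N))"
proof -
  have "(\<lambda>p. \<bar>step_function n \<alpha> p\<bar>) = step_function n \<alpha>" using \<alpha> by (auto simp: step_function_def)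
  then show ?thesis unfolding r_norm_def by (simp add: hom_density_step[OF N n])
qed

text \<open>Without edges the density is the average of an empty product and the exponent
  \<open>1 / 0\<close> is \<open>0\<close>, so even the zero function would get the value
  \<open>1 powr 0 = 1\<close>.\<close>

lemma weakly_norming_edges_nonempty:
  fixes N :: "'a ugraph"
  assumes N: "simple_graph N" "weakly_norming N"
  shows "edges N \<noteq> {}"
proof
  assume E: "edges N = {}"
  obtain A B where bip: "bipartition N A B" and norm: "is_norm (r_norm N A B)"
    using N(2) by (auto simp: weakly_norming_def)
  have zero: "step_function 1 (\<lambda>_. 0) = (\<lambda>_. 0)" by (simp add: step_function_def fun_eq_iff)
  have V: "finite (vertices N)" using N by (simp add: simple_graph_def)
  have "edge_weight (\<lambda>_ :: nat set. 0) ({} :: 'a set set) = (\<lambda>_. 1)"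
    by (simp add: edge_weight_def fun_eq_iff)
  then have "r_norm N A B (step_function 1 (\<lambda>_. 0)) = 1"
    using V by (subst r_norm_step[OF N(1) bip]) (simp_all add: E avg_const lessThan_empty_iff)
  moreover have "r_norm N A B (step_function 1 (\<lambda>_. 0)) = 0"
  proof -
    have "AE p in lebesgue_on unit_square. step_function 1 (\<lambda>_. 0) p = 0" unfolding zero by simp
    then show ?thesis using norm step_function_bounded_measurable[of 1 "\<lambda>_. 0"] unfolding is_norm_def by simp
  qed
  ultimately show False by simp
qed

text \<open>Step functions on a common grid are closed under addition, so the triangle inequality of
  the norm becomes one for finite averages, in the form that \<open>avg_subgraph_le_1\<close>
  takes.\<close>

lemma weakly_norming_triangle:
  fixes n :: nat
  assumes N: "simple_graph N" "weakly_norming N" and n: "0 < n"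
    and nonneg: "\<And>S. 0 \<le> \<alpha> S" "\<And>S. 0 \<le> \<beta> S"
  shows "avg {..<n} (vertices N) (edge_weight (\<lambda>S. \<alpha> S + \<beta> S) (edges N)) powr (1 / card (edges N)) \<le>
    avg {..<n} (vertices N) (edge_weight \<alpha> (edges N)) powr (1 / card (edges N)) +
    avg {..<n} (vertices N) (edge_weight \<beta> (edges N)) powr (1 / card (edges N))"
proof -
  obtain A B where bip: "bipartition N A B" and norm: "is_norm (r_norm N A B)"
    using N(2) by (auto simp: weakly_norming_def)
  have "(\<lambda>p. step_function n \<alpha> p + step_function n \<beta> p) = step_function n (\<lambda>S. \<alpha> S + \<beta> S)"
    by (simp add: step_function_def fun_eq_iff)
  then have "r_norm N A B (step_function n (\<lambda>S. \<alpha> S + \<beta> S)) \<le>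
      r_norm N A B (step_function n \<alpha>) + r_norm N A B (step_function n \<beta>)"
    using norm step_function_bounded_measurable[OF n] unfolding is_norm_def by metis
  then show ?thesis
    using nonneg by (simp add: r_norm_step[OF N(1) bip n] add_nonneg_nonneg)
qed

text \<open>Division by the norm \<open>\<rho>\<close> makes the density of \<open>N\<close> equal
  to one. The bound for subgraphs of \<open>N\<close> is then used twice: for the separators in the
  gluing, and for a single edge, where it says that the edge density of \<open>\<alpha>\<close> is
  at most \<open>\<rho>\<close>.\<close>

lemma sidorenko_step:
  fixes N :: "'b ugraph" and H :: "'a ugraph" and n :: nat
  assumes N: "simple_graph N" "weakly_norming N" and H: "simple_graph H"
    and dec: "N_decomposition N H F T" and n: "0 < n" and pos: "\<And>S. 0 < \<alpha> S"
  shows "((\<Sum>i<n. \<Sum>j<n. \<alpha> {i, j}) / real n ^ 2) ^ card (edges H) \<le>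
    avg {..<n} (vertices H) (edge_weight \<alpha> (edges H))"
proof -
  let ?V = "vertices N" and ?E = "edges N"
  define \<rho> where "\<rho> = avg {..<n} ?V (edge_weight \<alpha> ?E) powr (1 / card ?E)"
  define \<beta> where "\<beta> = (\<lambda>S. \<alpha> S / \<rho>)"
  have V: "finite ?V" using N by (simp add: simple_graph_def)
  have E: "finite ?E" "?E \<noteq> {}" and EV: "\<And>e. e \<in> ?E \<Longrightarrow> e \<subseteq> ?V"
    using simple_graph_finite_edges[OF N(1)] weakly_norming_edges_nonempty[OF N]
      simple_graph_edge_subset[OF N(1)] by auto
  have m: "0 < card ?E" using E by (simp add: card_gt_0_iff)
  have "0 < avg {..<n} ?V (edge_weight \<alpha> ?E)"
    using n V pos by (intro avg_pos) (auto simp: edge_weight_def prod_pos lessThan_empty_iff)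
  then have \<rho>: "0 < \<rho>" "\<rho> ^ card ?E = avg {..<n} ?V (edge_weight \<alpha> ?E)"
    using m by (simp_all add: \<rho>_def powr_realpow[symmetric] powr_powr)
  have \<beta>: "0 < \<beta> S" for S using pos \<rho> by (simp add: \<beta>_def)
  note scale = avg_edge_weight_scale[of _ _ \<alpha> \<rho>, folded \<beta>_def]
  interpret positive_target "{..<n}" \<beta>
    using n \<beta> by unfold_locales (auto simp: lessThan_empty_iff)
  have total: "avg {..<n} ?V (edge_weight \<beta> ?E) = 1"
    using \<rho>(1) by (simp add: scale \<rho>(2)[symmetric])
  have sub: "avg {..<n} ?V (edge_weight \<beta> K) \<le> 1" if "K \<subseteq> ?E" for K
    by (rule avg_subgraph_le_1[OF V E EV that weakly_norming_triangle[OF N] n less_imp_le[OF \<beta>] total])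
  obtain u v where uv: "{u, v} \<in> ?E" "u \<in> ?V" "v \<in> ?V" "u \<noteq> v"
    using E(2) N(1) unfolding simple_graph_def by (metis all_not_in_conv)
  have "(\<Sum>i<n. \<Sum>j<n. \<alpha> {i, j}) / real n ^ 2 = avg {..<n} ?V (edge_weight \<alpha> {{u, v}})"
    using avg_edge[OF V uv(2-4) n] by simp
  also have "\<dots> \<le> \<rho>" using sub[of "{{u, v}}"] uv \<rho> by (simp add: scale)
  finally have edge: "(\<Sum>i<n. \<Sum>j<n. \<alpha> {i, j}) / real n ^ 2 \<le> \<rho>" .
  have "1 \<le> avg {..<n} (vertices H) (edge_weight \<beta> (edges H))"
    by (rule one_le_avg_decomposition[OF N(1) H dec total sub])
  then have "\<rho> ^ card (edges H) \<le> avg {..<n} (vertices H) (edge_weight \<alpha> (edges H))"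
    using \<rho> by (simp add: scale)
  moreover have "0 \<le> (\<Sum>i<n. \<Sum>j<n. \<alpha> {i, j}) / real n ^ 2"
    using pos by (intro divide_nonneg_nonneg sum_nonneg) (auto intro: less_imp_le)
  ultimately show ?thesis using power_mono[OF edge] by (meson order_trans)
qed

theorem theorem5p12:
  fixes N :: "'b ugraph" and H :: "'a ugraph"
  assumes "simple_graph N" and "weakly_norming N"
    and "simple_graph H" and "N_decomposable N H"
  shows "sidorenko_property H"
  unfolding sidorenko_property_def
proof (intro conjI allI impI)
  show "bipartite H" using assms(4) by (simp add: N_decomposable_def)
next
  fix A B f
  assume bip: "bipartition H A B" and f: "f \<in> bounded_measurable"
    and nonneg: "\<forall>p \<in> unit_square. 0 \<le> f p"
    and sym: "\<forall>x \<in> {0..1}. \<forall>y \<in> {0..1}. f (x, y) = f (y, x)"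
  obtain F T where dec: "N_decomposition N H F T" using assms(4) by (auto simp: N_decomposable_def)
  \<comment> \<open>The approximants are strictly positive, as the divisions and logarithms of the
    gluing argument require; both sides of the inequality then pass to the limit.\<close>
  obtain n \<alpha> C Z where n: "\<And>k::nat. 0 < n k" and \<alpha>: "\<And>k S. 0 < \<alpha> k S"
    and C: "\<And>k p. p \<in> unit_square \<Longrightarrow> \<bar>step_function (n k) (\<alpha> k) p\<bar> \<le> C" and Z: "negligible Z"
    and lim: "\<And>p. p \<in> unit_square - Z \<Longrightarrow> (\<lambda>k. step_function (n k) (\<alpha> k) p) \<longlonglongrightarrow> f p"
    by (rule step_function_approximation[OF f]) (use nonneg sym in auto)
  have meas: "step_function (n k) (\<alpha> k) \<in> borel_measurable (lebesgue_on unit_square)"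
    "f \<in> borel_measurable (lebesgue_on unit_square)" for k
    using f by (auto simp: bounded_measurable_def intro: measurable_lebesgue_on)
  have "(\<lambda>k. (\<integral>p. step_function (n k) (\<alpha> k) p \<partial>lebesgue_on unit_square) ^ card (edges H)) \<longlonglongrightarrow>
      (\<integral>p. f p \<partial>lebesgue_on unit_square) ^ card (edges H)"
    by (intro tendsto_power integral_square_tendsto[OF meas C Z lim])
  note power_lim = this
  have "(\<lambda>k. hom_density H A B (step_function (n k) (\<alpha> k))) \<longlonglongrightarrow> hom_density H A B f"
    by (rule hom_density_tendsto[OF assms(3) bip meas C Z lim])
  note density_lim = this
  have "(\<integral>p. step_function (n k) (\<alpha> k) p \<partial>lebesgue_on unit_square) ^ card (edges H) \<le>
      hom_density H A B (step_function (n k) (\<alpha> k))" for k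
    unfolding integral_step_function[OF n] hom_density_step[OF assms(3) bip n]
    by (rule sidorenko_step[OF assms(1-3) dec n \<alpha>])
  then show "(\<integral>p. f p \<partial>lebesgue_on unit_square) ^ card (edges H) \<le> hom_density H A B f"
    by (intro LIMSEQ_le[OF power_lim density_lim]) blast
qed

end
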